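(* When the input point temporal graph $G=(V,E)$ has uniform delay one, the problem point-restless-temporal-path (given $G$, a source $s\in V$, a target $t\in V$ and $\Delta\in\mathbb{N}$, decide whether there is a $\Delta$-restless temporal path from $s$ to $t$ in $G$) can be solved in $\mathcal{O}(Mk2^k)$ deterministic time, where $M=|E|$ and $k$ is the vertex-interval-membership-width of $G$.
   Context: A point temporal graph $G=(V,E)$ consists of a finite set of nodes $V$ and a finite set of timed arcs $E\subseteq V\times V\times\mathbb{N}\times\mathbb{N}_{>0}$; a timed arc $(u,v,\tau,\delta)$ has appearance time $\tau$, delay $\delta$ and arrival time $\tau+\delta$. $G$ has uniform delay one if every timed arc has $\delta=1$. The lifetime is $\Lambda=\max\{\tau+\delta:(u,v,\tau,\delta)\in E\}$. The input is given as the list of timed arcs sorted by non-decreasing appearance time. A temporal path from $s=v_0$ to $t=v_\ell$ is a sequence of timed arcs $(v_{i-1},v_i,\tau_i,\delta_i)_{i=1,\dots,\ell}$ in $E$ with $\tau_i+\delta_i\le\tau_{i+1}$ for $1\le i\le\ell-1$ and $v_0,\dots,v_\ell$ pairwise distinct; it is $\Delta$-restless if $\tau_{i+1}-(\tau_i+\delta_i)\le\Delta$ for $1\le i\le\ell-1$. For $u\in V$ let $\tau^{min}(u)$ be the minimum appearance time of a timed arc having $u$ as an endpoint, and $\tau^{max}(u)$ the maximum arrival time of a timed arc having $u$ as an endpoint. For $\tau\in\{0,\dots,\Lambda\}$ let $F_\tau=\{u\in V:\tau^{min}(u)\le\tau\le\tau^{max}(u)\}$. The vertex-interval-membership-width of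 $G$ is $\max_{\tau\in\{0,\dots,\Lambda\}}|F_\tau|$. *)

theory Defs
  imports Main
begin

section \<open>Point temporal graphs\<close>

text \<open>A timed arc is a tuple (tail, head, appearance time, delay).\<close>

type_synonym 'v timed_arc = "'v \<times> 'v \<times> nat \<times> nat"

fun arc_tail :: "'v timed_arc \<Rightarrow> 'v" where "arc_tail (u, v, \<tau>, \<delta>) = u"
fun arc_head :: "'v timed_arc \<Rightarrow> 'v" where "arc_head (u, v, \<tau>, \<delta>) = v"
fun arc_time :: "'v timed_arc \<Rightarrow> nat" where "arc_time (u, v, \<tau>, \<delta>) = \<tau>"
fun arc_delay :: "'v timed_arc \<Rightarrow> nat" where "arc_delay (u, v, \<tau>, \<delta>) = \<delta>"
fun arc_arrival :: "'v timed_arc \<Rightarrow> nat" where "arc_arrival (u, v, \<tau>, \<delta>) = \<tau> + \<delta>"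

definition point_temporal_graph :: "'v set \<Rightarrow> 'v timed_arc set \<Rightarrow> bool" where
  "point_temporal_graph V E \<longleftrightarrow>
     finite V \<and> finite E \<and>
     (\<forall>e\<in>E. arc_tail e \<in> V \<and> arc_head e \<in> V \<and> 0 < arc_delay e)"

definition uniform_delay_one :: "'v timed_arc set \<Rightarrow> bool" where
  "uniform_delay_one E \<longleftrightarrow> (\<forall>e\<in>E. arc_delay e = 1)"

text \<open>The list \<open>p\<close> is 0-based, so \<open>p ! i\<close> is the arc from the node \<open>x i\<close> to the
  node \<open>x (Suc i)\<close>. The empty list is a temporal path from \<open>s\<close> to \<open>t\<close> exactly if \<open>s = t\<close>.\<close>

definition temporal_path :: "'v timed_arc set \<Rightarrow> 'v \<Rightarrow> 'v \<Rightarrow> 'v timed_arc list \<Rightarrow> bool" where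
  "temporal_path E s t p \<longleftrightarrow>
     (\<exists>x :: nat \<Rightarrow> 'v. x 0 = s \<and> x (length p) = t \<and> inj_on x {0..length p} \<and>
        (\<forall>i<length p. p ! i \<in> E \<and> arc_tail (p ! i) = x i \<and> arc_head (p ! i) = x (Suc i))) \<and>
     (\<forall>i. Suc i < length p \<longrightarrow> arc_arrival (p ! i) \<le> arc_time (p ! Suc i))"

text \<open>On a temporal path the truncated subtraction below is the exact waiting time.\<close>

definition restless :: "nat \<Rightarrow> 'v timed_arc list \<Rightarrow> bool" where
  "restless \<Delta> p \<longleftrightarrow>
     (\<forall>i. Suc i < length p \<longrightarrow> arc_time (p ! Suc i) - arc_arrival (p ! i) \<le> \<Delta>)"

definition point_restless_temporal_path :: "'v timed_arc set \<Rightarrow> 'v \<Rightarrow> 'v \<Rightarrow> nat \<Rightarrow> bool" where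
  "point_restless_temporal_path E s t \<Delta> \<longleftrightarrow> (\<exists>p. temporal_path E s t p \<and> restless \<Delta> p)"

definition incident_arcs :: "'v timed_arc set \<Rightarrow> 'v \<Rightarrow> 'v timed_arc set" where
  "incident_arcs E u = {e \<in> E. arc_tail e = u \<or> arc_head e = u}"

definition tau_min :: "'v timed_arc set \<Rightarrow> 'v \<Rightarrow> nat" where
  "tau_min E u = Min (arc_time ` incident_arcs E u)"

definition tau_max :: "'v timed_arc set \<Rightarrow> 'v \<Rightarrow> nat" where
  "tau_max E u = Max (arc_arrival ` incident_arcs E u)"

text \<open>The lifetime of a graph without arcs is taken to be 0. Nodes without incident arcs, for
  which \<open>tau_min\<close> and \<open>tau_max\<close> are meaningless, are active at no time.\<close>

definition lifetime :: "'v timed_arc set \<Rightarrow> nat" where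
  "lifetime E = (if E = {} then 0 else Max (arc_arrival ` E))"

definition active :: "'v set \<Rightarrow> 'v timed_arc set \<Rightarrow> nat \<Rightarrow> 'v set" where
  "active V E \<tau> =
     {u \<in> V. incident_arcs E u \<noteq> {} \<and> tau_min E u \<le> \<tau> \<and> \<tau> \<le> tau_max E u}"

definition vim_width :: "'v set \<Rightarrow> 'v timed_arc set \<Rightarrow> nat" where
  "vim_width V E = Max ((\<lambda>\<tau>. card (active V E \<tau>)) ` {0..lifetime E})"


section \<open>A word RAM\<close>

text \<open>Deterministic structured programs on a machine with \<open>w\<close>-bit words: finitely many registers
  are accessible to a given program, and the memory is addressed by words. Word operations have
  unit cost and compute modulo \<open>2 ^ w\<close>, so a single step cannot manipulate large integers.\<close>

datatype word_op =
  Add | Sub | Mul | Quot | Rem | BitAnd | BitOr | BitXor | ShiftL | ShiftR | Less | Leq | Equal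

datatype expr = Const nat | Reg nat | Load expr | Op word_op expr expr

datatype com =
    Skip
  | Assign nat expr
  | Store expr expr
  | Seq com com
  | If expr com com
  | While expr com

record state =
  regs :: "nat \<Rightarrow> nat"
  mem :: "nat \<Rightarrow> nat"

context
  includes bit_operations_syntax
begin

fun apply_op :: "nat \<Rightarrow> word_op \<Rightarrow> nat \<Rightarrow> nat \<Rightarrow> nat" where
  "apply_op w Add a b = (a + b) mod 2 ^ w"
| "apply_op w Sub a b = nat ((int a - int b) mod 2 ^ w)"
| "apply_op w Mul a b = (a * b) mod 2 ^ w"
| "apply_op w Quot a b = (a div b) mod 2 ^ w"
| "apply_op w Rem a b = (a mod b) mod 2 ^ w"
| "apply_op w BitAnd a b = (a AND b) mod 2 ^ w"
| "apply_op w BitOr a b = (a OR b) mod 2 ^ w"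
| "apply_op w BitXor a b = (a XOR b) mod 2 ^ w"
| "apply_op w ShiftL a b = (a * 2 ^ b) mod 2 ^ w"
| "apply_op w ShiftR a b = (a div 2 ^ b) mod 2 ^ w"
| "apply_op w Less a b = of_bool (a < b) mod 2 ^ w"
| "apply_op w Leq a b = of_bool (a \<le> b) mod 2 ^ w"
| "apply_op w Equal a b = of_bool (a = b) mod 2 ^ w"

end

fun eval_expr :: "nat \<Rightarrow> expr \<Rightarrow> state \<Rightarrow> nat" where
  "eval_expr w (Const n) \<sigma> = n mod 2 ^ w"
| "eval_expr w (Reg r) \<sigma> = regs \<sigma> r"
| "eval_expr w (Load a) \<sigma> = mem \<sigma> (eval_expr w a \<sigma>)"
| "eval_expr w (Op f a b) \<sigma> = apply_op w f (eval_expr w a \<sigma>) (eval_expr w b \<sigma>)"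

fun expr_cost :: "expr \<Rightarrow> nat" where
  "expr_cost (Const n) = 1"
| "expr_cost (Reg r) = 1"
| "expr_cost (Load a) = 1 + expr_cost a"
| "expr_cost (Op f a b) = 1 + expr_cost a + expr_cost b"

text \<open>\<open>exec w c \<sigma> n \<sigma>'\<close>: with word length \<open>w\<close>, the program \<open>c\<close> started in the state \<open>\<sigma>\<close>
  halts after \<open>n\<close> time units in the state \<open>\<sigma>'\<close>.\<close>

inductive exec :: "nat \<Rightarrow> com \<Rightarrow> state \<Rightarrow> nat \<Rightarrow> state \<Rightarrow> bool" for w :: nat where
  Skip: "exec w Skip \<sigma> 1 \<sigma>"
| Assign: "exec w (Assign r a) \<sigma> (1 + expr_cost a) (\<sigma>\<lparr>regs := (regs \<sigma>)(r := eval_expr w a \<sigma>)\<rparr>)"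
| Store: "exec w (Store a b) \<sigma> (1 + expr_cost a + expr_cost b)
            (\<sigma>\<lparr>mem := (mem \<sigma>)(eval_expr w a \<sigma> := eval_expr w b \<sigma>)\<rparr>)"
| Seq: "exec w c1 \<sigma>1 m \<sigma>2 \<Longrightarrow> exec w c2 \<sigma>2 n \<sigma>3 \<Longrightarrow> exec w (Seq c1 c2) \<sigma>1 (1 + m + n) \<sigma>3"
| IfTrue: "eval_expr w b \<sigma> \<noteq> 0 \<Longrightarrow> exec w c1 \<sigma> n \<sigma>' \<Longrightarrow>
            exec w (If b c1 c2) \<sigma> (1 + expr_cost b + n) \<sigma>'"
| IfFalse: "eval_expr w b \<sigma> = 0 \<Longrightarrow> exec w c2 \<sigma> n \<sigma>' \<Longrightarrow>
            exec w (If b c1 c2) \<sigma> (1 + expr_cost b + n) \<sigma>'"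
| WhileFalse: "eval_expr w b \<sigma> = 0 \<Longrightarrow> exec w (While b c) \<sigma> (1 + expr_cost b) \<sigma>"
| WhileTrue: "eval_expr w b \<sigma>1 \<noteq> 0 \<Longrightarrow> exec w c \<sigma>1 m \<sigma>2 \<Longrightarrow> exec w (While b c) \<sigma>2 n \<sigma>3 \<Longrightarrow>
            exec w (While b c) \<sigma>1 (1 + expr_cost b + m + n) \<sigma>3"

inductive_cases exec_SkipE: "exec w Skip \<sigma> n \<sigma>'"
inductive_cases exec_AssignE: "exec w (Assign r a) \<sigma> n \<sigma>'"
inductive_cases exec_StoreE: "exec w (Store a b) \<sigma> n \<sigma>'"
inductive_cases exec_SeqE: "exec w (Seq c1 c2) \<sigma> n \<sigma>'"
inductive_cases exec_IfE: "exec w (If b c1 c2) \<sigma> n \<sigma>'"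
inductive_cases exec_WhileE: "exec w (While b c) \<sigma> n \<sigma>'"

theorem exec_deterministic:
  "exec w c \<sigma> n \<sigma>' \<Longrightarrow> exec w c \<sigma> n' \<sigma>'' \<Longrightarrow> n' = n \<and> \<sigma>'' = \<sigma>'"
proof (induction arbitrary: n' \<sigma>'' rule: exec.induct)
  case Skip
  then show ?case by (auto elim: exec_SkipE)
next
  case Assign
  then show ?case by (auto elim: exec_AssignE)
next
  case Store
  then show ?case by (auto elim: exec_StoreE)
next
  case Seq
  from Seq.prems show ?case by (rule exec_SeqE) (auto dest!: Seq.IH)
next
  case IfTrue
  from IfTrue.prems show ?case by (rule exec_IfE) (auto dest!: IfTrue.IH simp: IfTrue.hyps)
next
  case IfFalse
  from IfFalse.prems show ?case by (rule exec_IfE) (auto dest!: IfFalse.IH simp: IfFalse.hyps)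
next
  case WhileFalse
  from WhileFalse.prems show ?case by (rule exec_WhileE) (simp_all add: WhileFalse.hyps)
next
  case WhileTrue
  from WhileTrue.prems show ?case
    by (rule exec_WhileE) (auto dest!: WhileTrue.IH simp: WhileTrue.hyps)
qed


section \<open>Input and output conventions\<close>

text \<open>Nodes are named by natural numbers. The input occupies the memory from address 0 on; all
  other memory cells and all registers are initially 0. The node set itself is not passed to the
  program. The answer is left in register 0.\<close>

definition input_words :: "nat timed_arc list \<Rightarrow> nat \<Rightarrow> nat \<Rightarrow> nat \<Rightarrow> nat list" where
  "input_words arcs s t \<Delta> =
     [length arcs, s, t, \<Delta>] @ concat (map (\<lambda>(u, v, \<tau>, \<delta>). [u, v, \<tau>, \<delta>]) arcs)"

definition initial_state :: "nat list \<Rightarrow> state" where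
  "initial_state ws = \<lparr>regs = (\<lambda>_. 0), mem = (\<lambda>a. if a < length ws then ws ! a else 0)\<rparr>"

definition arc_list_of :: "nat timed_arc set \<Rightarrow> nat timed_arc list \<Rightarrow> bool" where
  "arc_list_of E arcs \<longleftrightarrow> set arcs = E \<and> distinct arcs \<and> sorted (map arc_time arcs)"

text \<open>The bound \<open>M k 2 ^ k\<close>, where \<open>max 1\<close> only matters for graphs without arcs: with at least
  one arc, \<open>M\<close> and \<open>k\<close> are positive.\<close>

definition time_bound :: "nat set \<Rightarrow> nat timed_arc set \<Rightarrow> nat" where
  "time_bound V E = max 1 (card E * vim_width V E * 2 ^ vim_width V E)"

text \<open>The usual word RAM assumption, with constant \<open>C\<close>: a word can hold every input number and
  address a memory as large as the running time, up to a constant factor.\<close>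

definition word_length_ok :: "nat \<Rightarrow> nat list \<Rightarrow> nat \<Rightarrow> nat \<Rightarrow> bool" where
  "word_length_ok C ws T w \<longleftrightarrow> C * (Max (set ws) + T) \<le> 2 ^ w"

end

theory Submission
  imports Defs "HOL-Library.Nat_Bijection"
begin

text \<open>The arcs are scanned in order of time. A node is live between the first and the last arc incident
  to it; at any moment at most \<open>k\<close> nodes are live, and they hold distinct slots in \<open>{1..k}\<close>. The program
  keeps, for each set \<open>S\<close> of slots and each slot \<open>j\<close>, the latest arrival of a restless path from the
  source that ends in the node with slot \<open>j\<close> and whose live visited nodes have the slots \<open>S\<close>. Later
  arrivals are better, except that an arrival at \<open>\<tau> + 1\<close> is of no use for the other arcs of time \<open>\<tau>\<close>;
  with unit delays all arrivals known at time \<open>\<tau>\<close> are at most \<open>\<tau> + 1\<close>, so one further value per entry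
  suffices. An arc extends paths in \<open>O(2^k)\<close> steps, and when a node dies, the entries for \<open>S\<close> and
  \<open>S \<union> {j}\<close> are merged in \<open>O(k 2^k)\<close> steps so that its slot \<open>j\<close> can be reused. Each arc lets at
  most two nodes die.\<close>

section \<open>Running time bounds for structured programs\<close>

text \<open>No later arc touches a dead node: it can neither be revisited nor be left again, so
  forgetting it loses nothing. But the target may die in the very round in which it is reached, so
  the answer is recorded as soon as an arc enters it. The width \<open>k\<close> is unknown to the
  program: it takes the least free slot and keeps a running bound \<open>H\<close> on the slots in
  use. Counting live nodes gives \<open>H \<le> k + 1\<close>, so the loops over masks below
  \<open>2 ^ H\<close> have the right length without computing \<open>k\<close>. The row length of
  the table, however, must be fixed in advance; \<open>2 * M + 1\<close> is safe because
  \<open>M\<close> arcs have at most \<open>2 * M\<close> endpoints, and the addresses remain within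
  a constant multiple of the time bound. The value 0 does triple duty: slot 0 is reserved so that 0
  can mean "unassigned", arrival 0 means "none" because real arrivals are at least 1, and zeroed
  memory is an empty table that needs no initialisation. The argument has three levels:
  configurations with sets of nodes (\<open>reach\<close>), their images under the slot map
  (\<open>projection\<close>), and memory contents (\<open>represents\<close>,
  \<open>table\<close>).\<close>

definition runs :: "nat \<Rightarrow> com \<Rightarrow> state \<Rightarrow> nat \<Rightarrow> (state \<Rightarrow> bool) \<Rightarrow> bool" where
  "runs w c \<sigma> B Q \<longleftrightarrow> (\<exists>n \<sigma>'. exec w c \<sigma> n \<sigma>' \<and> n \<le> B \<and> Q \<sigma>')"

lemma runs_mono:
  assumes "runs w c \<sigma> B Q" "B \<le> B'" "\<And>\<sigma>'. Q \<sigma>' \<Longrightarrow> Q' \<sigma>'"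
  shows "runs w c \<sigma> B' Q'"
  using assms unfolding runs_def by (meson le_trans)

lemma runs_Seq:
  assumes "runs w c1 \<sigma> B1 Q1" "\<And>\<sigma>'. Q1 \<sigma>' \<Longrightarrow> runs w c2 \<sigma>' B2 Q"
  shows "runs w (Seq c1 c2) \<sigma> (1 + B1 + B2) Q"
proof -
  obtain n1 \<sigma>1 where 1: "exec w c1 \<sigma> n1 \<sigma>1" "n1 \<le> B1" "Q1 \<sigma>1"
    using assms(1) by (auto simp: runs_def)
  obtain n2 \<sigma>2 where 2: "exec w c2 \<sigma>1 n2 \<sigma>2" "n2 \<le> B2" "Q \<sigma>2"
    using assms(2)[OF 1(3)] by (auto simp: runs_def)
  show ?thesis
    unfolding runs_def using exec.Seq[OF 1(1) 2(1)] 1(2) 2(2,3)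
    by (intro exI[of _ "1 + n1 + n2"] exI[of _ \<sigma>2]) auto
qed

lemma runs_If:
  assumes "eval_expr w b \<sigma> \<noteq> 0 \<Longrightarrow> runs w c1 \<sigma> B Q" "eval_expr w b \<sigma> = 0 \<Longrightarrow> runs w c2 \<sigma> B Q"
  shows "runs w (If b c1 c2) \<sigma> (1 + expr_cost b + B) Q"
proof (cases "eval_expr w b \<sigma> = 0")
  case True
  then obtain n \<sigma>' where "exec w c2 \<sigma> n \<sigma>'" "n \<le> B" "Q \<sigma>'"
    using assms(2) by (auto simp: runs_def)
  then show ?thesis
    unfolding runs_def using exec.IfFalse[OF True]
    by (intro exI[of _ "1 + expr_cost b + n"] exI[of _ \<sigma>']) auto
next
  case False
  then obtain n \<sigma>' where "exec w c1 \<sigma> n \<sigma>'" "n \<le> B" "Q \<sigma>'"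
    using assms(1) by (auto simp: runs_def)
  then show ?thesis
    unfolding runs_def using exec.IfTrue[OF False]
    by (intro exI[of _ "1 + expr_cost b + n"] exI[of _ \<sigma>']) auto
qed

text \<open>\<open>n\<close> is the exact number of iterations and \<open>I i\<close> the invariant
  after \<open>i\<close> of them. The induction is on the iterations that remain, because
  \<open>exec\<close> unfolds a loop from its first round.\<close>

lemma runs_While:
  assumes init: "I 0 \<sigma>"
    and step: "\<And>i \<sigma>. i < n \<Longrightarrow> I i \<sigma> \<Longrightarrow> eval_expr w b \<sigma> \<noteq> 0 \<and> runs w c \<sigma> B (I (Suc i))"
    and stop: "\<And>\<sigma>. I n \<sigma> \<Longrightarrow> eval_expr w b \<sigma> = 0"
  shows "runs w (While b c) \<sigma> (n * (1 + expr_cost b + B) + (1 + expr_cost b)) (I n)"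
proof -
  have "runs w (While b c) \<sigma> (d * (1 + expr_cost b + B) + (1 + expr_cost b)) (I n)"
    if "d \<le> n" "I (n - d) \<sigma>" for d \<sigma>
    using that
  proof (induction d arbitrary: \<sigma>)
    case 0
    then show ?case
      unfolding runs_def using exec.WhileFalse[OF stop, of \<sigma>] by fastforce
  next
    case (Suc d)
    have lt: "n - Suc d < n" and eq: "Suc (n - Suc d) = n - d"
      using Suc.prems(1) by auto
    note st = step[OF lt Suc.prems(2)]
    obtain m \<sigma>1 where 1: "exec w c \<sigma> m \<sigma>1" "m \<le> B" "I (n - d) \<sigma>1"
      using st by (auto simp: runs_def eq)
    obtain m2 \<sigma>2 where 2: "exec w (While b c) \<sigma>1 m2 \<sigma>2"
        "m2 \<le> d * (1 + expr_cost b + B) + (1 + expr_cost b)" "I n \<sigma>2"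
      using Suc.IH[OF _ 1(3)] Suc.prems(1) by (auto simp: runs_def)
    show ?case
      unfolding runs_def using exec.WhileTrue[OF conjunct1[OF st] 1(1) 2(1)] 1(2) 2(2,3)
      by (intro exI[of _ "1 + expr_cost b + m + m2"] exI[of _ \<sigma>2]) auto
  qed
  from this[of n \<sigma>] init show ?thesis by simp
qed

text \<open>Straight-line code is executed symbolically: \<open>sem\<close> computes the final
  state, \<open>max_cost\<close> charges the costlier branch. The \<open>While\<close> clauses of
  both are dummies that \<open>loop_free\<close> excludes.\<close>

fun loop_free :: "com \<Rightarrow> bool" where
  "loop_free (Seq c1 c2) \<longleftrightarrow> loop_free c1 \<and> loop_free c2"
| "loop_free (If b c1 c2) \<longleftrightarrow> loop_free c1 \<and> loop_free c2"
| "loop_free (While b c) \<longleftrightarrow> False"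
| "loop_free _ \<longleftrightarrow> True"

fun max_cost :: "com \<Rightarrow> nat" where
  "max_cost Skip = 1"
| "max_cost (Assign r a) = 1 + expr_cost a"
| "max_cost (Store a b) = 1 + expr_cost a + expr_cost b"
| "max_cost (Seq c1 c2) = 1 + max_cost c1 + max_cost c2"
| "max_cost (If b c1 c2) = 1 + expr_cost b + max (max_cost c1) (max_cost c2)"
| "max_cost (While b c) = 0"

fun sem :: "nat \<Rightarrow> com \<Rightarrow> state \<Rightarrow> state" where
  "sem w Skip \<sigma> = \<sigma>"
| "sem w (Assign r a) \<sigma> = \<sigma>\<lparr>regs := (regs \<sigma>)(r := eval_expr w a \<sigma>)\<rparr>"
| "sem w (Store a b) \<sigma> = \<sigma>\<lparr>mem := (mem \<sigma>)(eval_expr w a \<sigma> := eval_expr w b \<sigma>)\<rparr>"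
| "sem w (Seq c1 c2) \<sigma> = sem w c2 (sem w c1 \<sigma>)"
| "sem w (If b c1 c2) \<sigma> = (if eval_expr w b \<sigma> \<noteq> 0 then sem w c1 \<sigma> else sem w c2 \<sigma>)"
| "sem w (While b c) \<sigma> = \<sigma>"

lemma runs_loop_free:
  assumes "loop_free c" "Q (sem w c \<sigma>)" "max_cost c \<le> B"
  shows "runs w c \<sigma> B Q"
proof -
  have "runs w c \<sigma> (max_cost c) (\<lambda>\<sigma>'. \<sigma>' = sem w c \<sigma>)"
    using assms(1)
  proof (induction c arbitrary: \<sigma>)
    case (Seq c1 c2)
    then have "loop_free c1" "loop_free c2" by auto
    show ?case unfolding max_cost.simps
      by (rule runs_Seq[OF Seq.IH(1)[OF \<open>loop_free c1\<close>]])
        (use Seq.IH(2)[OF \<open>loop_free c2\<close>] in auto)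
  next
    case (If b c1 c2)
    then have "loop_free c1" "loop_free c2" by auto
    show ?case unfolding max_cost.simps
      by (rule runs_If; rule runs_mono[OF If.IH(1)[OF \<open>loop_free c1\<close>]] runs_mono[OF If.IH(2)[OF \<open>loop_free c2\<close>]])
        auto
  qed (auto simp: runs_def intro: exec.intros)
  then show ?thesis by (rule runs_mono) (use assms in auto)
qed

section \<open>The program\<close>

text \<open>Memory is split into four interleaved arrays, so that cell \<open>n\<close> of array \<open>c\<close> has address
  \<open>4 * n + c\<close> and no bound on the node names has to be known. With \<open>M\<close> arcs, arc \<open>i\<close> occupies
  index \<open>Suc i\<close>. At index \<open>M + 1 + x\<close>, arrays 0 and 1 hold the last arc incident to node \<open>x\<close> and
  the slot of \<open>x\<close> (0 if none was assigned yet). At index \<open>M + 1 + (S * (2 * M + 1) + j)\<close>, arrays 3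
  and 2 hold the table entry for the bit mask \<open>S\<close> of visited slots and the slot \<open>j\<close> of the endpoint:
  the latest arrival, and, if that one lies in the future, the latest arrival that does not.

  Registers: 0 answer, 1 number of arcs, 2 source, 3 target, 4 waiting bound, 5 index of the current
  arc, 6 its tail, 7 its head, 8 its time, 9 bound on the slots used, 10 mask of the occupied slots;
  from 11 on temporaries.\<close>

definition addr_expr :: "nat \<Rightarrow> expr \<Rightarrow> expr" where
  "addr_expr c e = Op Add (Op Mul (Const 4) e) (Const c)"

definition node_expr :: "expr \<Rightarrow> expr" where
  "node_expr e = Op Add (Op Add (Reg 1) (Const 1)) e"

definition cell_expr :: "expr \<Rightarrow> expr \<Rightarrow> expr" where
  "cell_expr S j = node_expr (Op Add (Op Mul S (Op Add (Op Mul (Const 2) (Reg 1)) (Const 1))) j)"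

definition slot_expr :: "nat \<Rightarrow> expr" where
  "slot_expr r = Load (addr_expr 1 (node_expr (Reg r)))"

definition pow2_expr :: "expr \<Rightarrow> expr" where
  "pow2_expr e = Op ShiftL (Const 1) e"

text \<open>Shift and remainder instead of \<open>BitAnd\<close>, so that the value is literally
  \<open>S div 2 ^ j mod 2\<close>, the membership test of \<open>set_decode\<close>.\<close>

definition bit_expr :: "expr \<Rightarrow> expr \<Rightarrow> expr" where
  "bit_expr S j = Op Rem (Op ShiftR S j) (Const 2)"

lemma expr_cost_exprs [simp]:
  "expr_cost (addr_expr c e) = 4 + expr_cost e"
  "expr_cost (node_expr e) = 4 + expr_cost e"
  "expr_cost (cell_expr e e') = 11 + expr_cost e + expr_cost e'"
  "expr_cost (slot_expr r) = 10"
  "expr_cost (pow2_expr e) = 2 + expr_cost e"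
  "expr_cost (bit_expr e e') = 3 + expr_cost e + expr_cost e'"
  by (simp_all add: addr_expr_def node_expr_def cell_expr_def slot_expr_def pow2_expr_def bit_expr_def)

text \<open>The offset 1 skips the four header words, which fill index 0 of the four arrays.\<close>

definition load_arc :: com where
  "load_arc =
     Seq (Assign 6 (Load (addr_expr 0 (Op Add (Reg 5) (Const 1)))))
    (Seq (Assign 7 (Load (addr_expr 1 (Op Add (Reg 5) (Const 1)))))
         (Assign 8 (Load (addr_expr 2 (Op Add (Reg 5) (Const 1))))))"

definition incr :: "nat \<Rightarrow> com" where
  "incr r = Assign r (Op Add (Reg r) (Const 1))"

text \<open>Arcs are scanned in order, so overwriting leaves the last incident arc of each node;
  this tells later when the node dies.\<close>

definition last_body :: com where
  "last_body =
     Seq load_arc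
    (Seq (Store (addr_expr 0 (node_expr (Reg 6))) (Reg 5))
    (Seq (Store (addr_expr 0 (node_expr (Reg 7))) (Reg 5))
         (incr 5)))"

definition alloc_find :: com where
  "alloc_find = While (bit_expr (Reg 10) (Reg 11)) (incr 11)"

definition alloc_finish :: "nat \<Rightarrow> com" where
  "alloc_finish r =
     Seq (Store (addr_expr 1 (node_expr (Reg r))) (Reg 11))
    (Seq (Assign 10 (Op Add (Reg 10) (pow2_expr (Reg 11))))
         (If (Op Less (Reg 11) (Reg 9)) Skip (Assign 9 (Op Add (Reg 11) (Const 1)))))"

text \<open>A nonzero slot marks a node seen before; being touched by the current arc it is still
  live and still owns that slot. A linear search for a free slot costs \<open>O(k)\<close>, well
  within the budget of a round.\<close>

definition alloc :: "nat \<Rightarrow> com" where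
  "alloc r = If (slot_expr r) Skip
     (Seq (Assign 11 (Const 0)) (Seq alloc_find (alloc_finish r)))"

text \<open>Products are conjunctions and sums disjunctions, so the value can be 2 and is only
  compared with 0. The first summand starts a path at the source: the one-node path is not stored in
  the table. The factor \<open>0 < Reg 15\<close> excludes the code for "no arrival".\<close>

definition extend_test :: expr where
  "extend_test =
     Op Mul
       (Op Mul (bit_expr (Reg 12) (slot_expr 6)) (Op Equal (bit_expr (Reg 12) (slot_expr 7)) (Const 0)))
       (Op Add
         (Op Mul (Op Equal (Reg 6) (Reg 2)) (Op Equal (Reg 12) (pow2_expr (slot_expr 6))))
         (Op Mul (Op Less (Const 0) (Reg 15)) (Op Leq (Reg 8) (Op Add (Reg 15) (Reg 4)))))"

text \<open>Program version of \<open>current\<close>. The address in register \<open>a\<close> lies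
  in array 2 (the fall-back value); the next word, in array 3, is the latest arrival.\<close>

definition current_arrival :: "nat \<Rightarrow> nat \<Rightarrow> com" where
  "current_arrival r a =
     Seq (Assign r (Load (Op Add (Reg a) (Const 1))))
         (If (Op Leq (Reg r) (Reg 8)) Skip (Assign r (Load (Reg a))))"

text \<open>Updating the table in place is sound: the masks read lack the slot of the head, those written
  contain it.\<close>

definition extend_body :: com where
  "extend_body =
     Seq (Assign 13 (addr_expr 2 (cell_expr (Reg 12) (slot_expr 6))))
    (Seq (Assign 14 (addr_expr 2 (cell_expr (Op Add (Reg 12) (pow2_expr (slot_expr 7))) (slot_expr 7))))
    (Seq (current_arrival 15 13)
    (Seq (If extend_test
            (Seq (current_arrival 16 14)
            (Seq (Store (Reg 14) (Reg 16))
            (Seq (Store (Op Add (Reg 14) (Const 1)) (Op Add (Reg 8) (Const 1)))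
                 (If (Op Equal (Reg 7) (Reg 3)) (Assign 0 (Const 1)) Skip))))
            Skip)
         (incr 12))))"

definition extend :: com where
  "extend = Seq (Assign 12 (Const 0)) (While (Op Less (Reg 12) (pow2_expr (Reg 9))) extend_body)"

text \<open>A single counter runs over all pairs: its quotient by the slot bound is the mask, its
  remainder the slot. Zeroing the latest arrival alone empties an entry, since
  \<open>current\<close> then ignores the fall-back value.\<close>

definition merge_body :: com where
  "merge_body =
     Seq (If (bit_expr (Op Quot (Reg 12) (Reg 9)) (Reg 11)) Skip
       (Seq (Assign 13 (addr_expr 2 (cell_expr (Op Quot (Reg 12) (Reg 9)) (Op Rem (Reg 12) (Reg 9)))))
       (Seq (Assign 14 (addr_expr 2 (cell_expr (Op Add (Op Quot (Reg 12) (Reg 9)) (pow2_expr (Reg 11)))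
               (Op Rem (Reg 12) (Reg 9)))))
       (Seq (current_arrival 15 13)
       (Seq (current_arrival 16 14)
       (Seq (If (Op Less (Reg 15) (Reg 16)) (Assign 15 (Reg 16)) Skip)
       (Seq (Store (Reg 13) (Reg 15))
       (Seq (If (Op Less (Load (Op Add (Reg 13) (Const 1))) (Load (Op Add (Reg 14) (Const 1))))
               (Store (Op Add (Reg 13) (Const 1)) (Load (Op Add (Reg 14) (Const 1)))) Skip)
            (Store (Op Add (Reg 14) (Const 1)) (Const 0))))))))))
      (incr 12)"

definition merge :: com where
  "merge = Seq (Assign 12 (Const 0))
     (While (Op Less (Reg 12) (Op Mul (Reg 9) (pow2_expr (Reg 9)))) merge_body)"

text \<open>The second test only fails for the head of a self-loop, whose slot was released as that of
  the tail.\<close>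

definition free :: "nat \<Rightarrow> com" where
  "free r = Seq (Assign 11 (slot_expr r))
     (If (Op Mul (Op Equal (Load (addr_expr 0 (node_expr (Reg r)))) (Reg 5)) (bit_expr (Reg 10) (Reg 11)))
       (Seq merge (Assign 10 (Op Sub (Reg 10) (pow2_expr (Reg 11)))))
       Skip)"

definition arc_body :: com where
  "arc_body = Seq load_arc (Seq (alloc 6) (Seq (alloc 7) (Seq extend (Seq (free 6) (Seq (free 7) (incr 5))))))"

text \<open>The values 1 in registers 9 and 10 reserve slot 0. The initial answer accounts for the
  empty path.\<close>

definition init :: com where
  "init =
     Seq (Assign 1 (Load (Const 0)))
    (Seq (Assign 2 (Load (Const 1)))
    (Seq (Assign 3 (Load (Const 2)))
    (Seq (Assign 4 (Load (Const 3)))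
    (Seq (Assign 9 (Const 1))
    (Seq (Assign 10 (Const 1))
         (Assign 0 (Op Equal (Reg 2) (Reg 3))))))))"

definition prog :: com where
  "prog = Seq init
     (Seq (While (Op Less (Reg 5) (Reg 1)) last_body)
     (Seq (Assign 5 (Const 0))
          (While (Op Less (Reg 5) (Reg 1)) arc_body)))"

section \<open>Masks\<close>

lemma set_decode_iff: "j \<in> set_decode S \<longleftrightarrow> S div 2 ^ j mod 2 = 1"
  by (simp add: set_decode_def odd_iff_mod_2_eq_one)

lemma set_decode_add_power:
  assumes "j \<notin> set_decode S"
  shows "set_decode (S + 2 ^ j) = insert j (set_decode S)"
  using set_decode_plus_power_2[OF assms] by (simp add: add.commute)

lemma set_decode_diff_power:
  assumes "j \<in> set_decode S"
  shows "2 ^ j \<le> S" "set_decode (S - 2 ^ j) = set_decode S - {j}"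
proof -
  have "S = 2 ^ j + set_encode (set_decode S - {j})"
    using set_encode_insert[of "set_decode S - {j}" j] assms by (simp add: insert_absorb)
  then show "2 ^ j \<le> S" "set_decode (S - 2 ^ j) = set_decode S - {j}"
    by (metis le_add1, metis diff_add_inverse finite_Diff finite_set_decode set_encode_inverse)
qed

lemma set_decode_subset_lessThan_iff: "set_decode S \<subseteq> {..<H} \<longleftrightarrow> S < 2 ^ H"
proof
  assume "set_decode S \<subseteq> {..<H}"
  then have "set_encode (set_decode S) \<le> set_encode {..<H}"
    unfolding set_encode_def by (simp add: sum_mono2)
  also have "\<dots> < 2 ^ H"
    by (simp add: set_encode_def lessThan_atLeast0 sum_power2)
  finally show "S < 2 ^ H" by simp
next
  assume S: "S < 2 ^ H"
  show "set_decode S \<subseteq> {..<H}"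
  proof
    fix j assume "j \<in> set_decode S"
    then have "(2::nat) ^ j < 2 ^ H" using set_decode_diff_power(1) S by (meson le_less_trans)
    then show "j \<in> {..<H}" by simp
  qed
qed

section \<open>Table entries\<close>

text \<open>With \<open>n\<close> the maximum of a set of arrivals and \<open>d\<close> the maximum of those up to time \<open>\<tau>\<close>,
  0 standing for none; \<open>d\<close> is only stored faithfully if it differs from \<open>n\<close>. Since delays are one,
  \<open>n > \<tau>\<close> means \<open>n = \<tau> + 1\<close>.\<close>

definition current :: "nat \<Rightarrow> nat \<Rightarrow> nat \<Rightarrow> nat" where
  "current \<tau> d n = (if n \<le> \<tau> then n else d)"

definition represents :: "nat \<Rightarrow> nat \<Rightarrow> nat \<Rightarrow> nat set \<Rightarrow> bool" where
  "represents \<tau> d n R \<longleftrightarrow>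
     R \<subseteq> {1..Suc \<tau>} \<and> (\<forall>a\<in>R. a \<le> n) \<and> (n \<noteq> 0 \<longrightarrow> n \<in> R) \<and>
     (\<forall>a\<in>R. a \<le> \<tau> \<longrightarrow> a \<le> current \<tau> d n) \<and>
     (current \<tau> d n \<noteq> 0 \<longrightarrow> current \<tau> d n \<in> R \<and> current \<tau> d n \<le> \<tau>)"

text \<open>The condition \<open>\<tau> \<le> a + \<Delta>\<close> is upward closed in
  \<open>a\<close>, so it suffices to test the largest arrival up to \<open>\<tau>\<close>.\<close>

lemma represents_usable:
  assumes "represents \<tau> d n R"
  shows "(\<exists>a\<in>R. a \<le> \<tau> \<and> \<tau> \<le> a + \<Delta>) \<longleftrightarrow> current \<tau> d n \<noteq> 0 \<and> \<tau> \<le> current \<tau> d n + \<Delta>"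
proof
  assume "\<exists>a\<in>R. a \<le> \<tau> \<and> \<tau> \<le> a + \<Delta>"
  then obtain a where a: "a \<in> R" "a \<le> \<tau>" "\<tau> \<le> a + \<Delta>" by auto
  then have "a \<le> current \<tau> d n" "1 \<le> a" using assms by (auto simp: represents_def)
  then show "current \<tau> d n \<noteq> 0 \<and> \<tau> \<le> current \<tau> d n + \<Delta>" using a by linarith
next
  assume "current \<tau> d n \<noteq> 0 \<and> \<tau> \<le> current \<tau> d n + \<Delta>"
  then show "\<exists>a\<in>R. a \<le> \<tau> \<and> \<tau> \<le> a + \<Delta>" using assms by (auto simp: represents_def)
qed

lemma represents_empty: "represents \<tau> d 0 {}"
  by (simp add: represents_def current_def)

text \<open>As soon as time advances, the arrival \<open>\<tau> + 1\<close> is no longer in the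
  future, so the maximum itself becomes current and the fall-back value may be stale.\<close>

lemma represents_later:
  assumes "represents \<tau> d n R" "\<tau> \<le> \<tau>'"
  shows "represents \<tau>' d n R"
proof (cases "\<tau> = \<tau>'")
  case False
  then have "Suc \<tau> \<le> \<tau>'" using assms(2) by simp
  moreover have "n \<le> Suc \<tau>" using assms(1) by (cases "n = 0") (auto simp: represents_def)
  ultimately show ?thesis using assms(1) by (auto simp: represents_def current_def)
qed (use assms in simp)

text \<open>\<open>\<tau> + 1\<close> dominates every arrival known so far; what was current is
  saved as the fall-back for other arcs of time \<open>\<tau>\<close>.\<close>

lemma represents_insert:
  assumes "represents \<tau> d n R"
  shows "represents \<tau> (current \<tau> d n) (Suc \<tau>) (insert (Suc \<tau>) R)"
  using assms by (auto simp: represents_def current_def)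

text \<open>Maxima and current arrivals are combined separately: one maximum may lie in the future
  while the other entry supplies the best usable arrival.\<close>

lemma represents_union:
  assumes "represents \<tau> d n R" "represents \<tau> d' n' R'"
  shows "represents \<tau> (max (current \<tau> d n) (current \<tau> d' n')) (max n n') (R \<union> R')"
proof -
  have eq: "current \<tau> (max (current \<tau> d n) (current \<tau> d' n')) (max n n')
      = max (current \<tau> d n) (current \<tau> d' n')"
    by (auto simp: current_def)
  show ?thesis
    using assms unfolding represents_def eq
    by (intro conjI) (auto simp: max_def split: if_splits)
qed

section \<open>Reachable configurations\<close>

locale temporal_input =
  fixes arcs :: "nat timed_arc list" and s t \<Delta> :: nat
  assumes delay: "\<And>e. e \<in> set arcs \<Longrightarrow> arc_delay e = 1"
    and arcs_sorted: "sorted (map arc_time arcs)"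
begin

definition M :: nat where "M = length arcs"
definition src :: "nat \<Rightarrow> nat" where "src i = arc_tail (arcs ! i)"
definition dst :: "nat \<Rightarrow> nat" where "dst i = arc_head (arcs ! i)"
definition tm :: "nat \<Rightarrow> nat" where "tm i = arc_time (arcs ! i)"

lemma arrival: "i < M \<Longrightarrow> arc_arrival (arcs ! i) = Suc (tm i)"
  using delay[OF nth_mem[of i arcs]] by (cases "arcs ! i") (auto simp: M_def tm_def)

lemma tm_mono: "i \<le> j \<Longrightarrow> j < M \<Longrightarrow> tm i \<le> tm j"
  using sorted_nth_mono[OF arcs_sorted, of i j] by (simp add: M_def tm_def)

text \<open>Node set, end and arrival of the nonempty restless paths from \<open>s\<close> over the first \<open>i\<close> arcs.\<close>

primrec reach :: "nat \<Rightarrow> (nat set \<times> nat \<times> nat) set" where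
  "reach 0 = {}"
| "reach (Suc i) = reach i \<union> {(insert (dst i) X, dst i, Suc (tm i)) | X. dst i \<notin> X \<and>
      (src i = s \<and> X = {s} \<or> (\<exists>a. (X, src i, a) \<in> reach i \<and> a \<le> tm i \<and> tm i \<le> a + \<Delta>))}"

text \<open>The one-node path is a separate case because it has no arrival: the first arc may be
  taken at any time.\<close>

definition extendable :: "nat \<Rightarrow> nat set \<Rightarrow> bool" where
  "extendable i X \<longleftrightarrow> dst i \<notin> X \<and>
      (src i = s \<and> X = {s} \<or> (\<exists>a. (X, src i, a) \<in> reach i \<and> a \<le> tm i \<and> tm i \<le> a + \<Delta>))"

lemma reach_Suc: "reach (Suc i) = reach i \<union> {(insert (dst i) X, dst i, Suc (tm i)) | X. extendable i X}"
  by (simp add: extendable_def)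

declare reach.simps(2) [simp del]

lemma reach_mono: "i \<le> j \<Longrightarrow> reach i \<subseteq> reach j"
  by (rule lift_Suc_mono_le) (auto simp: reach_Suc)

section \<open>Configurations correspond to restless temporal paths\<close>

definition walk :: "nat timed_arc list \<Rightarrow> (nat \<Rightarrow> nat) \<Rightarrow> bool" where
  "walk p x \<longleftrightarrow> x 0 = s \<and> inj_on x {0..length p} \<and>
     (\<forall>i<length p. p ! i \<in> set arcs \<and> arc_tail (p ! i) = x i \<and> arc_head (p ! i) = x (Suc i)) \<and>
     (\<forall>i. Suc i < length p \<longrightarrow> arc_arrival (p ! i) \<le> arc_time (p ! Suc i) \<and>
        arc_time (p ! Suc i) \<le> arc_arrival (p ! i) + \<Delta>)"

lemma walk_iff: "point_restless_temporal_path (set arcs) s t \<Delta> \<longleftrightarrow> (\<exists>p x. walk p x \<and> x (length p) = t)"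
  unfolding point_restless_temporal_path_def temporal_path_def restless_def walk_def
  by (simp add: le_diff_conv add.commute) blast

lemma walk_snoc:
  assumes "walk p x" "i < M" "x (length p) = src i" "dst i \<notin> x ` {0..length p}"
    and "p \<noteq> [] \<Longrightarrow> arc_arrival (last p) \<le> tm i \<and> tm i \<le> arc_arrival (last p) + \<Delta>"
  shows "walk (p @ [arcs ! i]) (x(Suc (length p) := dst i))"
proof -
  have "inj_on (x(Suc (length p) := dst i)) {0..Suc (length p)}"
    using assms(1,4) unfolding walk_def
    by (auto simp: atLeast0_atMost_Suc inj_on_def image_iff Ball_def)
  moreover have "arc_arrival ((p @ [arcs ! i]) ! j) \<le> arc_time ((p @ [arcs ! i]) ! Suc j) \<and>
        arc_time ((p @ [arcs ! i]) ! Suc j) \<le> arc_arrival ((p @ [arcs ! i]) ! j) + \<Delta>"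
    if "Suc j < length (p @ [arcs ! i])" for j
  proof (cases "Suc j < length p")
    case True
    then show ?thesis using assms(1) by (auto simp: walk_def nth_append)
  next
    case False
    then have "Suc j = length p" using that by simp
    then show ?thesis using assms(5)
      by (cases p rule: rev_cases) (auto simp: nth_append tm_def)
  qed
  ultimately show ?thesis
    using assms(1-3) unfolding walk_def
    by (auto simp: nth_append M_def src_def dst_def less_Suc_eq)
qed

lemma reach_sound:
  assumes "(X, v, a) \<in> reach i" "i \<le> M"
  shows "\<exists>p x. p \<noteq> [] \<and> walk p x \<and> x (length p) = v \<and> X = x ` {0..length p} \<and> arc_arrival (last p) = a"
  using assms
proof (induction i arbitrary: X v a)
  case (Suc i)
  show ?case
  proof (cases "(X, v, a) \<in> reach i")
    case True
    then show ?thesis using Suc by simp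
  next
    case False
    then obtain Y where Y: "X = insert (dst i) Y" "v = dst i" "a = Suc (tm i)" "extendable i Y"
      using Suc.prems by (auto simp: reach_Suc)
    \<comment> \<open>The empty walk and the walks from the induction hypothesis are unified here;
      only a nonempty walk carries a waiting condition.\<close>
    have "\<exists>p x. walk p x \<and> x (length p) = src i \<and> Y = x ` {0..length p} \<and>
        (p \<noteq> [] \<longrightarrow> arc_arrival (last p) \<le> tm i \<and> tm i \<le> arc_arrival (last p) + \<Delta>)"
    proof (cases "src i = s \<and> Y = {s}")
      case True
      then have "walk [] (\<lambda>_. s)" by (simp add: walk_def)
      then show ?thesis using True by (intro exI[of _ "[]"] exI[of _ "\<lambda>_. s"]) auto
    next
      case False
      then obtain b where "(Y, src i, b) \<in> reach i" "b \<le> tm i" "tm i \<le> b + \<Delta>"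
        using Y(4) by (auto simp: extendable_def)
      then show ?thesis using Suc.IH[of Y "src i" b] Suc.prems by fastforce
    qed
    then obtain p x where p: "walk p x" "x (length p) = src i" "Y = x ` {0..length p}"
        "p \<noteq> [] \<Longrightarrow> arc_arrival (last p) \<le> tm i \<and> tm i \<le> arc_arrival (last p) + \<Delta>"
      by blast
    have iM: "i < M" using Suc.prems by simp
    have "walk (p @ [arcs ! i]) (x(Suc (length p) := dst i))"
      using walk_snoc[OF p(1) iM p(2) _ p(4)] Y(4) p(3) by (auto simp: extendable_def)
    moreover have "X = (x(Suc (length p) := dst i)) ` {0..length (p @ [arcs ! i])}"
      using Y(1) p(3) by (auto simp: atLeast0_atMost_Suc)
    ultimately show ?thesis
      using arrival[OF iM] Y by (intro exI[of _ "p @ [arcs ! i]"] exI[of _ "x(Suc (length p) := dst i)"])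
        (simp del: fun_upd_apply, simp)
  qed
qed simp

text \<open>Induction along the walk: each prefix enters \<open>reach\<close> when the scan passes
  its last arc, provided the arcs of the walk occur in the list in the order of the walk.\<close>

lemma reach_complete:
  assumes "walk p x" "l < length p"
  shows "\<exists>q<M. arcs ! q = p ! l \<and> (x ` {0..Suc l}, x (Suc l), arc_arrival (p ! l)) \<in> reach (Suc q)"
  using assms(2)
proof (induction l)
  case 0
  obtain q where q: "q < M" "arcs ! q = p ! 0"
    using assms(1) 0 by (auto simp: walk_def M_def in_set_conv_nth)
  have x: "x 0 = s" "src q = x 0" "dst q = x 1"
    using assms(1) 0 q by (auto simp: walk_def src_def dst_def)
  have "x 1 \<noteq> x 0"
    using assms(1) 0 inj_onD[of x "{0..length p}" 1 0] by (auto simp: walk_def Suc_le_eq)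
  note x = x this
  then have "extendable q {s}" by (simp add: extendable_def)
  moreover have "x ` {0..Suc 0} = insert (dst q) {s}"
    using x by (auto simp: atLeast0_atMost_Suc)
  ultimately show ?case
    using q x arrival[OF q(1)] by (intro exI[of _ q]) (auto simp: reach_Suc)
next
  case (Suc l)
  obtain q where q: "q < M" "arcs ! q = p ! l"
      "(x ` {0..Suc l}, x (Suc l), arc_arrival (p ! l)) \<in> reach (Suc q)"
    using Suc by auto
  obtain r where r: "r < M" "arcs ! r = p ! Suc l"
    using assms(1) Suc.prems by (auto simp: walk_def M_def in_set_conv_nth)
  have t: "arc_arrival (p ! l) \<le> tm r" "tm r \<le> arc_arrival (p ! l) + \<Delta>"
    using assms(1) Suc.prems r by (auto simp: walk_def tm_def)
  \<comment> \<open>Delay one makes times strictly increase along the walk, so sortedness puts arc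
    \<open>r\<close> after arc \<open>q\<close> however ties are ordered.\<close>
  then have "tm q < tm r" using arrival[OF q(1)] q(2) by simp
  then have "q < r" using tm_mono[of r q] q(1) by (meson leD leI)
  then have "(x ` {0..Suc l}, x (Suc l), arc_arrival (p ! l)) \<in> reach r"
    using q(3) reach_mono[of "Suc q" r] by auto
  moreover have x: "src r = x (Suc l)" "dst r = x (Suc (Suc l))"
    using assms(1) Suc.prems r by (auto simp: walk_def src_def dst_def)
  moreover have "x (Suc (Suc l)) \<notin> x ` {0..Suc l}"
    using assms(1) Suc.prems unfolding walk_def by (subst inj_on_image_mem_iff) auto
  ultimately have "extendable r (x ` {0..Suc l})" using t by (auto simp: extendable_def)
  moreover have "x ` {0..Suc (Suc l)} = insert (dst r) (x ` {0..Suc l})"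
    using x by (auto simp: atLeast0_atMost_Suc)
  ultimately show ?case
    using r x arrival[OF r(1)] by (intro exI[of _ r]) (auto simp: reach_Suc)
qed

theorem reach_correct:
  "point_restless_temporal_path (set arcs) s t \<Delta> \<longleftrightarrow> s = t \<or> (\<exists>X a. (X, t, a) \<in> reach M)"
proof
  assume "point_restless_temporal_path (set arcs) s t \<Delta>"
  then obtain p x where p: "walk p x" "x (length p) = t" by (auto simp: walk_iff)
  show "s = t \<or> (\<exists>X a. (X, t, a) \<in> reach M)"
  proof (cases "length p")
    case 0
    then show ?thesis using p by (simp add: walk_def)
  next
    case (Suc l)
    then obtain q X a where "q < M" "(X, t, a) \<in> reach (Suc q)"
      using reach_complete[OF p(1), of l] p(2) by auto
    then show ?thesis using reach_mono[of "Suc q" M] by auto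
  qed
next
  assume "s = t \<or> (\<exists>X a. (X, t, a) \<in> reach M)"
  moreover have "walk [] (\<lambda>_. s)" by (simp add: walk_def)
  ultimately show "point_restless_temporal_path (set arcs) s t \<Delta>"
    unfolding walk_iff using reach_sound[of _ t _ M] by fastforce
qed

section \<open>Live nodes\<close>

definition incident :: "nat \<Rightarrow> nat \<Rightarrow> bool" where
  "incident i x \<longleftrightarrow> src i = x \<or> dst i = x"

definition seen :: "nat \<Rightarrow> nat set" where
  "seen i = {x. \<exists>p<i. incident p x}"

text \<open>Liveness is measured by arc indices, not by times, so a slot can be reused even between
  two arcs of equal time.\<close>

definition live :: "nat \<Rightarrow> nat set" where
  "live i = seen i \<inter> {x. \<exists>q. i \<le> q \<and> q < M \<and> incident q x}"

lemma seen_Suc: "seen (Suc i) = insert (src i) (insert (dst i) (seen i))"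
  by (auto simp: seen_def incident_def less_Suc_eq)

lemma finite_seen: "finite (seen i)"
  by (induction i) (simp add: seen_def, simp add: seen_Suc)

lemma reach_props:
  assumes "(X, v, a) \<in> reach i"
  shows "v \<in> X \<and> X \<subseteq> seen i \<and> 1 \<le> a \<and> (\<exists>p<i. a = Suc (tm p))"
  using assms
proof (induction i arbitrary: X v a)
  case (Suc i)
  show ?case
  proof (cases "(X, v, a) \<in> reach i")
    case True
    then show ?thesis using Suc.IH[OF True] by (auto simp: seen_Suc less_Suc_eq)
  next
    case False
    then obtain Y where Y: "X = insert (dst i) Y" "v = dst i" "a = Suc (tm i)" "extendable i Y"
      using Suc.prems by (auto simp: reach_Suc)
    have "Y \<subseteq> seen (Suc i)"
      using Y(4) Suc.IH[of Y] by (auto simp: extendable_def seen_Suc)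
    then show ?thesis using Y by (auto simp: seen_Suc)
  qed
qed simp

text \<open>A node incident to arcs \<open>p \<le> i \<le> q\<close> is active at time
  \<open>tm i\<close>, as indices and times are ordered alike. The endpoints of arc \<open>i\<close>
  are added because they need slots in round \<open>i\<close> even if this is their first or last
  arc.\<close>

lemma live_active:
  assumes "point_temporal_graph V (set arcs)" "i < M"
  shows "card (insert (src i) (insert (dst i) (live i))) \<le> vim_width V (set arcs)"
proof -
  let ?E = "set arcs" and ?A = "insert (src i) (insert (dst i) (live i))"
  have mem: "arcs ! p \<in> ?E" if "p < M" for p using that by (simp add: M_def)
  have "?A \<subseteq> active V ?E (tm i)"
  proof
    fix x assume "x \<in> ?A"
    then have "(\<exists>p\<le>i. incident p x) \<and> (\<exists>q\<ge>i. q < M \<and> incident q x)"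
      using assms(2) by (auto simp: live_def seen_def incident_def intro: less_imp_le)
    then obtain p q where pq: "p \<le> i" "incident p x" "i \<le> q" "q < M" "incident q x" by auto
    have inc: "arcs ! p \<in> incident_arcs ?E x" "arcs ! q \<in> incident_arcs ?E x"
      using pq assms(2) mem by (auto simp: incident_arcs_def incident_def src_def dst_def)
    have fin: "finite (incident_arcs ?E x)" by (simp add: incident_arcs_def)
    have "tau_min ?E x \<le> tm p"
      unfolding tau_min_def tm_def using inc fin by (intro Min_le) auto
    also have "tm p \<le> tm i" using tm_mono pq assms(2) by simp
    finally have 1: "tau_min ?E x \<le> tm i" .
    have "tm i \<le> tm q" using tm_mono pq by simp
    also have "\<dots> \<le> arc_arrival (arcs ! q)" using arrival pq by simp
    also have "\<dots> \<le> tau_max ?E x"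
      unfolding tau_max_def using inc fin by (intro Max_ge) auto
    finally have 2: "tm i \<le> tau_max ?E x" .
    have "x \<in> V" using assms(1) mem[OF pq(4)] pq(5)
      by (auto simp: point_temporal_graph_def incident_def src_def dst_def)
    then show "x \<in> active V ?E (tm i)" using 1 2 inc by (auto simp: active_def)
  qed
  moreover have "finite (active V ?E (tm i))"
    using assms(1) by (auto simp: active_def point_temporal_graph_def)
  ultimately have "card ?A \<le> card (active V ?E (tm i))" by (rule card_mono[rotated])
  also have "tm i \<le> lifetime ?E"
  proof -
    have "tm i \<le> arc_arrival (arcs ! i)" using arrival assms(2) by simp
    also have "\<dots> \<le> Max (arc_arrival ` ?E)" using mem[OF assms(2)] by (intro Max_ge) auto
    finally show ?thesis using mem[OF assms(2)] by (auto simp: lifetime_def)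
  qed
  then have "card (active V ?E (tm i)) \<le> vim_width V ?E"
    unfolding vim_width_def by (intro Max_ge) auto
  finally show ?thesis .
qed

end

section \<open>Memory layout and evaluation of expressions\<close>

text \<open>\<open>word_nodes\<close> covers node cells, at most
  \<open>4 * (mx + 1 + mx) + 1\<close>, and sums of two input numbers; \<open>word_masks\<close>
  covers the counter of \<open>merge\<close>. \<open>word_table\<close> allows masks up to
  \<open>2 ^ (k + 2)\<close>, because adding a power to a mask of \<open>k + 1\<close> bits may
  produce one more bit.\<close>

locale ram_input = temporal_input +
  fixes w k mx :: nat
  assumes arc_bound: "\<And>i. i < M \<Longrightarrow> src i \<le> mx \<and> dst i \<le> mx \<and> tm i \<le> mx"
    and input_bound: "M \<le> mx" "\<Delta> \<le> mx"
    and word_nodes: "8 * mx + 16 \<le> 2 ^ w"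
    and word_table: "4 * M + 4 + 4 * (2 ^ (k + 2) * (2 * M + 1)) \<le> 2 ^ w"
    and word_masks: "(k + 1) * 2 ^ (k + 1) < 2 ^ w"
    and width_le: "k \<le> 2 * M"
    and width: "\<And>i. i < M \<Longrightarrow> card (insert (src i) (insert (dst i) (live i))) \<le> k"
begin

text \<open>Room for slots \<open>0\<close> to \<open>2 * M\<close>, hence for all slots up to
  \<open>k\<close>, by a quantity that the program knows.\<close>

definition stride :: nat where "stride = 2 * M + 1"

definition in_addr :: "nat \<Rightarrow> nat \<Rightarrow> nat" where "in_addr c i = 4 * (i + 1) + c"
definition last_addr :: "nat \<Rightarrow> nat" where "last_addr x = 4 * (M + 1 + x) + 0"
definition slot_addr :: "nat \<Rightarrow> nat" where "slot_addr x = 4 * (M + 1 + x) + 1"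
definition old_addr :: "nat \<Rightarrow> nat \<Rightarrow> nat" where "old_addr S j = 4 * (M + 1 + (S * stride + j)) + 2"
definition new_addr :: "nat \<Rightarrow> nat \<Rightarrow> nat" where "new_addr S j = 4 * (M + 1 + (S * stride + j)) + 3"

lemmas addr_defs = in_addr_def last_addr_def slot_addr_def old_addr_def new_addr_def

lemma index_eq_iff:
  assumes "j < stride" "j' < stride"
  shows "S * stride + j = S' * stride + j' \<longleftrightarrow> S = S' \<and> j = j'"
proof
  assume eq: "S * stride + j = S' * stride + j'"
  have "(S * stride + j) div stride = S" "(S' * stride + j') div stride = S'"
    using assms by (intro div_nat_eqI; simp)+
  then have "S = S'" using eq by metis
  then show "S = S' \<and> j = j'" using eq by simp
qed simp

lemma quad_eq_iff:
  fixes a b c d :: nat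
  assumes "c < 4" "d < 4"
  shows "4 * a + c = 4 * b + d \<longleftrightarrow> a = b \<and> c = d"
  using assms by presburger

lemma addr_eq_iff [simp]:
  "last_addr x = last_addr y \<longleftrightarrow> x = y"
  "slot_addr x = slot_addr y \<longleftrightarrow> x = y"
  "last_addr x \<noteq> slot_addr y" "slot_addr y \<noteq> last_addr x"
  "last_addr x \<noteq> old_addr S j" "old_addr S j \<noteq> last_addr x"
  "last_addr x \<noteq> new_addr S j" "new_addr S j \<noteq> last_addr x"
  "slot_addr x \<noteq> old_addr S j" "old_addr S j \<noteq> slot_addr x"
  "slot_addr x \<noteq> new_addr S j" "new_addr S j \<noteq> slot_addr x"
  "old_addr S j \<noteq> new_addr S' j'" "new_addr S' j' \<noteq> old_addr S j"
  unfolding addr_defs by (subst quad_eq_iff; simp)+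

lemma in_addr_neq [simp]:
  assumes "i < M" "c < 4"
  shows "in_addr c i \<noteq> last_addr x" "in_addr c i \<noteq> slot_addr x"
    "in_addr c i \<noteq> old_addr S j" "in_addr c i \<noteq> new_addr S j"
proof -
  have "4 * (i + 1) + c < 4 * (M + 1)" using assms by simp
  then show "in_addr c i \<noteq> last_addr x" "in_addr c i \<noteq> slot_addr x"
    "in_addr c i \<noteq> old_addr S j" "in_addr c i \<noteq> new_addr S j"
    unfolding addr_defs distrib_left by linarith+
qed

lemma cell_addr_eq_iff [simp]:
  assumes "j \<le> 2 * M" "j' \<le> 2 * M"
  shows "old_addr S j = old_addr S' j' \<longleftrightarrow> S = S' \<and> j = j'"
    "new_addr S j = new_addr S' j' \<longleftrightarrow> S = S' \<and> j = j'"
  using index_eq_iff[of j j' S S'] assms by (simp_all add: addr_defs stride_def del: mult_Suc_right)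

lemma Suc_old_addr [simp]: "Suc (old_addr S j) = new_addr S j" "old_addr S j + 1 = new_addr S j"
  by (simp_all add: addr_defs)

lemma table_index_bound:
  assumes "S < 2 ^ (k + 2)" "j \<le> 2 * M"
  shows "4 * M + 4 + 4 * (S * stride) + 4 * j + 3 < 2 ^ w"
proof -
  have "S * stride + j < Suc S * stride" using assms(2) by (simp add: stride_def)
  also have "\<dots> \<le> 2 ^ (k + 2) * stride" using assms(1) by (intro mult_right_mono) auto
  finally show ?thesis using word_table unfolding stride_def[symmetric] by linarith
qed

lemma new_addr_less [simp]: "S < 2 ^ (k + 2) \<Longrightarrow> j \<le> 2 * M \<Longrightarrow> new_addr S j < 2 ^ w"
  using table_index_bound[of S j] by (simp add: addr_defs)

lemma word_consts [simp]: "0 < w" "Suc 0 < 2 ^ w" "2 < (2::nat) ^ w" "3 < (2::nat) ^ w" "4 < (2::nat) ^ w"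
proof -
  show "4 < (2::nat) ^ w" "2 < (2::nat) ^ w" "Suc 0 < 2 ^ w" "3 < (2::nat) ^ w" using word_nodes by linarith+
  show "0 < w" using \<open>Suc 0 < 2 ^ w\<close> by (cases w) auto
qed

lemma mask_less: "j \<le> k + 2 \<Longrightarrow> (2::nat) ^ j < 2 ^ w"
proof -
  have "(2::nat) ^ (k + 2) \<le> 2 ^ (k + 2) * stride" by (simp add: stride_def)
  then have "(2::nat) ^ (k + 2) < 2 ^ w" using word_table unfolding stride_def[symmetric] by linarith
  then show "j \<le> k + 2 \<Longrightarrow> (2::nat) ^ j < 2 ^ w"
    by (meson le_less_trans one_le_numeral power_increasing)
qed

lemma of_bool_mod [simp]: "(of_bool b :: nat) mod 2 ^ w = of_bool b"
  by (cases b) auto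

lemma small_mod [simp]: "Suc 0 mod 2 ^ w = Suc 0" "(2::nat) mod 2 ^ w = 2" "3 mod 2 ^ w = (3::nat)"
    "4 mod 2 ^ w = (4::nat)"
  by (simp_all del: One_nat_def)

section \<open>Values of address, slot and mask expressions\<close>

lemma eval_node:
  assumes "regs \<sigma> 1 = M" "eval_expr w e \<sigma> = x" "x \<le> mx"
  shows "eval_expr w (addr_expr 0 (node_expr e)) \<sigma> = last_addr x"
    "eval_expr w (addr_expr 1 (node_expr e)) \<sigma> = slot_addr x"
  using assms word_nodes input_bound by (simp_all add: addr_expr_def node_expr_def addr_defs)

lemma eval_slot:
  assumes "regs \<sigma> 1 = M" "regs \<sigma> r \<le> mx"
  shows "eval_expr w (slot_expr r) \<sigma> = mem \<sigma> (slot_addr (regs \<sigma> r))"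
  unfolding slot_expr_def eval_expr.simps(3) by (subst eval_node(2)[OF assms(1) _ assms(2)]) simp_all

lemma eval_cell:
  assumes "regs \<sigma> 1 = M" "eval_expr w eS \<sigma> = S" "eval_expr w ej \<sigma> = j" "S < 2 ^ (k + 2)" "j \<le> 2 * M"
  shows "eval_expr w (addr_expr 2 (cell_expr eS ej)) \<sigma> = old_addr S j"
proof -
  note b = table_index_bound[OF assms(4,5)]
  have 1: "eval_expr w (Op Mul eS (Op Add (Op Mul (Const 2) (Reg 1)) (Const 1))) \<sigma> = S * stride"
    using b assms word_nodes input_bound by (simp add: stride_def)
  have 2: "eval_expr w (Op Add (Op Add (Reg 1) (Const 1))
      (Op Add (Op Mul eS (Op Add (Op Mul (Const 2) (Reg 1)) (Const 1))) ej)) \<sigma> = M + 1 + (S * stride + j)"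
    unfolding eval_expr.simps(4)[of _ _ _ ej] eval_expr.simps(4)[of _ _ "Op Add (Reg 1) (Const 1)"] 1
    using b assms by simp
  show ?thesis
    unfolding addr_expr_def cell_expr_def node_expr_def old_addr_def
      eval_expr.simps(4)[of _ _ _ "Const 2"] eval_expr.simps(4)[of _ _ "Const 4"] 2
    using b by simp
qed

lemma eval_bit:
  assumes "eval_expr w e \<sigma> = S" "S < 2 ^ w" "eval_expr w e' \<sigma> = j"
  shows "eval_expr w (bit_expr e e') \<sigma> = of_bool (j \<in> set_decode S)"
proof -
  have "S div 2 ^ j < 2 ^ w" using assms(2) by (meson div_le_dividend le_less_trans)
  then show ?thesis using assms by (auto simp: bit_expr_def set_decode_iff)
qed

lemma eval_pow2:
  assumes "eval_expr w e \<sigma> = j" "j \<le> k + 2"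
  shows "eval_expr w (pow2_expr e) \<sigma> = 2 ^ j"
  using assms mask_less by (simp add: pow2_expr_def)

lemma sem_current_arrival:
  assumes "regs \<sigma> a = old_addr S j" "S < 2 ^ (k + 2)" "j \<le> 2 * M" "r \<noteq> a" "r \<noteq> 8"
  shows "sem w (current_arrival r a) \<sigma> = \<sigma>\<lparr>regs := (regs \<sigma>)
    (r := current (regs \<sigma> 8) (mem \<sigma> (old_addr S j)) (mem \<sigma> (new_addr S j)))\<rparr>"
  using assms by (auto simp: current_arrival_def current_def)

section \<open>State assertions\<close>

definition frame :: "(nat \<Rightarrow> nat) \<Rightarrow> (nat \<Rightarrow> nat) \<Rightarrow> nat \<Rightarrow> nat \<Rightarrow> bool \<Rightarrow> nat \<Rightarrow> state \<Rightarrow> bool" where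
  "frame lst slt occ H b i \<sigma> \<longleftrightarrow>
     regs \<sigma> 0 = of_bool b \<and> regs \<sigma> 1 = M \<and> regs \<sigma> 2 = s \<and> regs \<sigma> 3 = t \<and> regs \<sigma> 4 = \<Delta> \<and>
     regs \<sigma> 5 = i \<and> regs \<sigma> 9 = H \<and> regs \<sigma> 10 = occ \<and>
     (\<forall>p<M. mem \<sigma> (in_addr 0 p) = src p \<and> mem \<sigma> (in_addr 1 p) = dst p \<and> mem \<sigma> (in_addr 2 p) = tm p) \<and>
     (\<forall>x. mem \<sigma> (last_addr x) = lst x \<and> mem \<sigma> (slot_addr x) = slt x)"

definition arc_frame :: "(nat \<Rightarrow> nat) \<Rightarrow> (nat \<Rightarrow> nat) \<Rightarrow> nat \<Rightarrow> nat \<Rightarrow> bool \<Rightarrow> nat \<Rightarrow> state \<Rightarrow> bool" where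
  "arc_frame lst slt occ H b i \<sigma> \<longleftrightarrow> frame lst slt occ H b i \<sigma> \<and> i < M \<and>
     regs \<sigma> 6 = src i \<and> regs \<sigma> 7 = dst i \<and> regs \<sigma> 8 = tm i"

text \<open>Entries whose mask does not contain the endpoint's slot are never read; releasing a slot may
  leave arbitrary values there.\<close>

definition table :: "nat \<Rightarrow> (nat \<Rightarrow> nat \<Rightarrow> nat set) \<Rightarrow> state \<Rightarrow> bool" where
  "table \<tau> R \<sigma> \<longleftrightarrow> (\<forall>S j. j \<le> 2 * M \<longrightarrow> j \<in> set_decode S \<longrightarrow>
     represents \<tau> (mem \<sigma> (old_addr S j)) (mem \<sigma> (new_addr S j)) (R S j))"

lemmas frame_defs = frame_def arc_frame_def table_def

lemma arc_frame_temp [simp]: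
  "11 \<le> r \<Longrightarrow> arc_frame lst slt occ H b i (\<sigma>\<lparr>regs := (regs \<sigma>)(r := a)\<rparr>) \<longleftrightarrow> arc_frame lst slt occ H b i \<sigma>"
  by (simp add: frame_def arc_frame_def)

lemma table_regs [simp]: "table \<tau> R (\<sigma>\<lparr>regs := f\<rparr>) \<longleftrightarrow> table \<tau> R \<sigma>"
  by (simp add: table_def)

lemma runs_load_arc:
  assumes "frame lst slt occ H b i \<sigma>" "table \<tau> R \<sigma>" "i < M"
  shows "runs w load_arc \<sigma> 29 (\<lambda>\<sigma>'. arc_frame lst slt occ H b i \<sigma>' \<and> table \<tau> R \<sigma>')"
proof -
  have "eval_expr w (addr_expr c (Op Add (Reg 5) (Const 1))) \<sigma>' = in_addr c i"
    if "regs \<sigma>' 5 = i" "c < 4" for \<sigma>' c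
    using that assms(3) word_nodes input_bound
    by (simp add: addr_expr_def addr_defs)
  note ev = this
  show ?thesis
    using assms ev
    by (intro runs_loop_free) (auto simp: load_arc_def frame_defs)
qed

lemma runs_incr5:
  assumes "frame lst slt occ H b i \<sigma>" "table \<tau> R \<sigma>" "i < M"
  shows "runs w (incr 5) \<sigma> 4 (\<lambda>\<sigma>'. frame lst slt occ H b (Suc i) \<sigma>' \<and> table \<tau> R \<sigma>')"
  using assms word_nodes input_bound
  by (intro runs_loop_free) (auto simp: incr_def frame_defs)

text \<open>\<open>j\<^sub>0\<close> is any free slot up to \<open>k\<close>; the search stops at
  the least free one, hence after at most \<open>k\<close> rounds.\<close>

lemma runs_alloc_find:
  assumes "arc_frame lst slt occ H b i \<sigma>" "table \<tau> R \<sigma>" "regs \<sigma> 11 = 0" "occ < 2 ^ w"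
    and "j\<^sub>0 \<notin> set_decode occ" "j\<^sub>0 \<le> k"
  shows "runs w alloc_find \<sigma> (k * 10 + 6) (\<lambda>\<sigma>'. arc_frame lst slt occ H b i \<sigma>' \<and> table \<tau> R \<sigma>' \<and>
     regs \<sigma>' 11 \<le> k \<and> regs \<sigma>' 11 \<notin> set_decode occ)"
proof -
  define n where "n = (LEAST j. j \<notin> set_decode occ)"
  have n: "n \<notin> set_decode occ" "n \<le> j\<^sub>0" "\<And>j. j < n \<Longrightarrow> j \<in> set_decode occ"
    using LeastI[of "\<lambda>j. j \<notin> set_decode occ", OF assms(5)] Least_le[of "\<lambda>j. j \<notin> set_decode occ", OF assms(5)]
    unfolding n_def by (auto dest: not_less_Least)
  define I where "I = (\<lambda>j \<sigma>'. arc_frame lst slt occ H b i \<sigma>' \<and> table \<tau> R \<sigma>' \<and> regs \<sigma>' 11 = j)"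
  have ev: "eval_expr w (bit_expr (Reg 10) (Reg 11)) \<sigma>' = of_bool (j \<in> set_decode occ)" if "I j \<sigma>'" for j \<sigma>'
    by (rule eval_bit) (use that assms(4) in \<open>auto simp: I_def frame_defs\<close>)
  have kw: "k < 2 ^ w" using word_nodes input_bound width_le by linarith
  have "runs w alloc_find \<sigma> (n * (1 + expr_cost (bit_expr (Reg 10) (Reg 11)) + 4)
      + (1 + expr_cost (bit_expr (Reg 10) (Reg 11)))) (I n)"
    unfolding alloc_find_def
  proof (rule runs_While)
    show "I 0 \<sigma>" using assms by (simp add: I_def)
    show "eval_expr w (bit_expr (Reg 10) (Reg 11)) \<sigma>' \<noteq> 0 \<and> runs w (incr 11) \<sigma>' 4 (I (Suc j))"
      if "j < n" "I j \<sigma>'" for j \<sigma>'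
    proof
      show "eval_expr w (bit_expr (Reg 10) (Reg 11)) \<sigma>' \<noteq> 0" using ev[OF that(2)] n(3)[OF that(1)] by simp
      have "Suc j < 2 ^ w" using that(1) n(2) assms(6) kw by linarith
      then show "runs w (incr 11) \<sigma>' 4 (I (Suc j))"
        using that by (intro runs_loop_free) (auto simp: incr_def I_def frame_defs)
    qed
    show "eval_expr w (bit_expr (Reg 10) (Reg 11)) \<sigma>' = 0" if "I n \<sigma>'" for \<sigma>'
      using ev[OF that] n(1) by simp
  qed
  then show ?thesis
    by (rule runs_mono) (use n assms(6) in \<open>auto simp: I_def\<close>)
qed

lemma runs_alloc_finish:
  assumes "arc_frame lst slt occ H b i \<sigma>" "table \<tau> R \<sigma>" "regs \<sigma> 11 = j" "j \<le> k" "occ < 2 ^ (k + 1)"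
    and "r = 6 \<and> x = src i \<or> r = 7 \<and> x = dst i"
  shows "runs w (alloc_finish r) \<sigma> 30 (\<lambda>\<sigma>'.
     arc_frame lst (slt(x := j)) (occ + 2 ^ j) (max H (Suc j)) b i \<sigma>' \<and> table \<tau> R \<sigma>')"
proof -
  have "x \<le> mx" using assms(1,6) arc_bound by (auto simp: frame_defs)
  moreover have "j < 2 ^ w" "Suc j < 2 ^ w" using word_nodes input_bound width_le assms(4) by linarith+
  moreover have "occ + 2 ^ j < 2 ^ w"
  proof -
    have "(2::nat) ^ j \<le> 2 ^ (k + 1)" using assms(4) by (intro power_increasing) auto
    then show ?thesis using assms(5) mask_less[of "k + 2"] by simp
  qed
  moreover have "eval_expr w (addr_expr 1 (node_expr (Reg r))) \<sigma> = slot_addr x"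
    using assms(1,6) \<open>x \<le> mx\<close> by (intro eval_node(2)) (auto simp: frame_defs)
  moreover have "eval_expr w (pow2_expr (Reg 11)) \<sigma>' = 2 ^ j" if "regs \<sigma>' 11 = j" for \<sigma>'
    by (rule eval_pow2) (use assms(4) that in simp_all)
  moreover have "max H (Suc j) = (if j < H then H else Suc j)" by simp
  ultimately show ?thesis
    using assms(1-3)
    by (intro runs_loop_free) (simp_all add: alloc_finish_def frame_defs)
qed

lemma runs_alloc:
  assumes "arc_frame lst slt occ H b i \<sigma>" "table \<tau> R \<sigma>" "occ < 2 ^ (k + 1)"
    and "r = 6 \<and> x = src i \<or> r = 7 \<and> x = dst i"
    and "slt x = 0 \<Longrightarrow> j\<^sub>0 \<notin> set_decode occ \<and> j\<^sub>0 \<le> k"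
  shows "runs w (alloc r) \<sigma> (10 * k + 60) (\<lambda>\<sigma>'. if slt x = 0
     then \<exists>j\<le>k. j \<notin> set_decode occ \<and>
       arc_frame lst (slt(x := j)) (occ + 2 ^ j) (max H (Suc j)) b i \<sigma>' \<and> table \<tau> R \<sigma>'
     else arc_frame lst slt occ H b i \<sigma>' \<and> table \<tau> R \<sigma>')" (is "runs _ _ _ _ ?Q")
proof -
  have "regs \<sigma> r = x" "x \<le> mx" "regs \<sigma> 1 = M"
    using assms(1,4) arc_bound by (auto simp: frame_defs)
  then have ev: "eval_expr w (slot_expr r) \<sigma> = slt x"
    using assms(1) by (simp add: eval_slot frame_defs)
  have occ: "occ < 2 ^ w" using assms(3) mask_less[of "k + 1"] by simp
  have "runs w (alloc r) \<sigma> (1 + expr_cost (slot_expr r) + (10 * k + 40)) ?Q"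
    unfolding alloc_def
  proof (rule runs_If)
    assume "eval_expr w (slot_expr r) \<sigma> \<noteq> 0"
    then show "runs w Skip \<sigma> (10 * k + 40) ?Q"
      using ev assms(1,2) by (intro runs_loop_free) auto
  next
    assume "eval_expr w (slot_expr r) \<sigma> = 0"
    then have 0: "slt x = 0" using ev by simp
    have 1: "runs w (Assign 11 (Const 0)) \<sigma> 2 (\<lambda>\<sigma>'. arc_frame lst slt occ H b i \<sigma>' \<and> table \<tau> R \<sigma>' \<and> regs \<sigma>' 11 = 0)"
      using assms(1,2) by (intro runs_loop_free) (auto simp: frame_defs)
    have 2: "runs w alloc_find \<sigma>' (k * 10 + 6) (\<lambda>\<sigma>'. arc_frame lst slt occ H b i \<sigma>' \<and> table \<tau> R \<sigma>' \<and>
        regs \<sigma>' 11 \<le> k \<and> regs \<sigma>' 11 \<notin> set_decode occ)"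
      if "arc_frame lst slt occ H b i \<sigma>' \<and> table \<tau> R \<sigma>' \<and> regs \<sigma>' 11 = 0" for \<sigma>'
      using that assms(5)[OF 0] by (intro runs_alloc_find[OF _ _ _ occ]) auto
    have 3: "runs w (alloc_finish r) \<sigma>' 30 ?Q"
      if "arc_frame lst slt occ H b i \<sigma>' \<and> table \<tau> R \<sigma>' \<and> regs \<sigma>' 11 \<le> k \<and> regs \<sigma>' 11 \<notin> set_decode occ" for \<sigma>'
      by (rule runs_mono[OF runs_alloc_finish[of lst slt occ H b i \<sigma>' \<tau> R "regs \<sigma>' 11" r x]])
        (use that assms(3,4) 0 in auto)
    show "runs w (Seq (Assign 11 (Const 0)) (Seq alloc_find (alloc_finish r))) \<sigma> (10 * k + 40) ?Q"
      by (rule runs_mono[OF runs_Seq[OF 1 runs_Seq[OF 2 3]]]) auto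
  qed
  then show ?thesis by (rule runs_mono) auto
qed

section \<open>Extending paths by an arc\<close>

text \<open>Counterpart of \<open>extendable\<close> on slots; \<open>2 ^ ju\<close> is the mask of
  the one-node path at the source.\<close>

definition admits :: "nat \<Rightarrow> (nat \<Rightarrow> nat \<Rightarrow> nat set) \<Rightarrow> nat \<Rightarrow> nat \<Rightarrow> nat \<Rightarrow> bool" where
  "admits i R ju jv S \<longleftrightarrow> ju \<in> set_decode S \<and> jv \<notin> set_decode S \<and>
     (src i = s \<and> S = 2 ^ ju \<or> (\<exists>a\<in>R S ju. a \<le> tm i \<and> tm i \<le> a + \<Delta>))"

text \<open>Guarantees that loops over masks below \<open>2 ^ H\<close> miss no relevant
  entry.\<close>

definition bounded :: "nat \<Rightarrow> (nat \<Rightarrow> nat \<Rightarrow> nat set) \<Rightarrow> bool" where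
  "bounded H R \<longleftrightarrow> (\<forall>S j. j \<in> set_decode S \<longrightarrow> R S j \<noteq> {} \<longrightarrow> S < 2 ^ H)"

definition extended :: "nat \<Rightarrow> (nat \<Rightarrow> nat \<Rightarrow> nat set) \<Rightarrow> nat \<Rightarrow> nat \<Rightarrow> nat \<Rightarrow> nat \<Rightarrow> nat set" where
  "extended i R ju jv S j =
     (if j = jv \<and> jv \<in> set_decode S \<and> admits i R ju jv (S - 2 ^ jv) then insert (Suc (tm i)) (R S j) else R S j)"

lemma eval_extend_test:
  assumes "regs \<sigma> 1 = M" "regs \<sigma> 2 = s" "regs \<sigma> 4 = \<Delta>" "regs \<sigma> 6 = u" "regs \<sigma> 7 = v" "regs \<sigma> 8 = \<tau>"
    "u \<le> mx" "v \<le> mx" "mem \<sigma> (slot_addr u) = ju" "mem \<sigma> (slot_addr v) = jv" "ju \<le> k"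
    "regs \<sigma> 12 < 2 ^ w" "ju \<in> set_decode (regs \<sigma> 12) \<Longrightarrow> regs \<sigma> 15 + \<Delta> < 2 ^ w"
  shows "eval_expr w extend_test \<sigma> \<noteq> 0 \<longleftrightarrow> ju \<in> set_decode (regs \<sigma> 12) \<and> jv \<notin> set_decode (regs \<sigma> 12) \<and>
     (u = s \<and> regs \<sigma> 12 = 2 ^ ju \<or> 0 < regs \<sigma> 15 \<and> \<tau> \<le> regs \<sigma> 15 + \<Delta>)"
proof -
  have 1: "eval_expr w (slot_expr 6) \<sigma> = ju" "eval_expr w (slot_expr 7) \<sigma> = jv"
    using assms by (simp_all add: eval_slot)
  have 2: "eval_expr w (pow2_expr (slot_expr 6)) \<sigma> = 2 ^ ju"
    using 1 assms(11) by (intro eval_pow2) auto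
  have 3: "eval_expr w (bit_expr (Reg 12) (slot_expr 6)) \<sigma> = of_bool (ju \<in> set_decode (regs \<sigma> 12))"
      "eval_expr w (bit_expr (Reg 12) (slot_expr 7)) \<sigma> = of_bool (jv \<in> set_decode (regs \<sigma> 12))"
    using 1 assms(12) by (rule_tac eval_bit; simp)+
  \<comment> \<open>The sum in the test can be 2, which must not wrap to 0.\<close>
  have "Suc (Suc 0) < 2 ^ w" using word_consts(3) by linarith
  then show ?thesis
    using assms by (auto simp: extend_test_def 1 2 3)
qed

lemma extend_body_cost: "loop_free extend_body" "max_cost extend_body \<le> 250"
  by (simp_all add: extend_body_def current_arrival_def incr_def extend_test_def)

lemma runs_extend:
  assumes "arc_frame lst slt occ H b i \<sigma>" "table (tm i) R \<sigma>"
    and slots: "slt (src i) = ju" "slt (dst i) = jv" "ju < H" "jv < H" "H \<le> k + 1"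
    and R: "bounded H R"
  shows "runs w extend \<sigma> (2 ^ (k + 1) * 300 + 30) (\<lambda>\<sigma>'.
     arc_frame lst slt occ H (b \<or> dst i = t \<and> (\<exists>S. admits i R ju jv S)) i \<sigma>' \<and>
     table (tm i) (extended i R ju jv) \<sigma>')"
proof -
  let ?adm = "admits i R ju jv" and ?\<tau> = "tm i"
  \<comment> \<open>The table once the masks below \<open>m\<close> are processed. Progress at a
    written entry is measured by the mask it was computed from, \<open>S - 2 ^ jv\<close>, not by
    its own.\<close>
  define Rm where "Rm = (\<lambda>m S j. if j = jv \<and> jv \<in> set_decode S \<and> S - 2 ^ jv < m \<and> ?adm (S - 2 ^ jv)
      then insert (Suc ?\<tau>) (R S j) else R S j)"
  define I where "I = (\<lambda>m \<sigma>'. arc_frame lst slt occ H (b \<or> dst i = t \<and> (\<exists>S<m. ?adm S)) i \<sigma>' \<and>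
      table ?\<tau> (Rm m) \<sigma>' \<and> regs \<sigma>' 12 = m)"
  have i: "i < M" using assms(1) by (simp add: arc_frame_def)
  have uv: "src i \<le> mx" "dst i \<le> mx" "?\<tau> \<le> mx" using arc_bound[OF i] by auto
  have j: "ju \<le> k" "jv \<le> k" "ju \<le> 2 * M" "jv \<le> 2 * M" using slots width_le by auto
  have pH: "(2::nat) ^ H \<le> 2 ^ (k + 1)" using slots(5) by (intro power_increasing) auto
  have pj: "(2::nat) ^ jv \<le> 2 ^ k" using j by (intro power_increasing) auto
  have pw: "(2::nat) ^ (k + 2) < 2 ^ w" by (rule mask_less) simp
  \<comment> \<open>An admissible mask is either \<open>2 ^ ju\<close> with \<open>ju < H\<close> or
    has a nonempty entry, so the loop bound loses none.\<close>
  have adm_less: "S < 2 ^ H" if "?adm S" for S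
    using that R slots(3) by (auto simp: admits_def bounded_def)
  have ev: "eval_expr w (pow2_expr (Reg 9)) \<sigma>' = 2 ^ H" if "I m \<sigma>'" for m \<sigma>'
    by (rule eval_pow2) (use that slots(5) in \<open>auto simp: I_def frame_defs\<close>)
  have step: "runs w extend_body \<sigma>' 250 (I (Suc m))" if m: "m < 2 ^ H" and Im: "I m \<sigma>'" for m \<sigma>'
  proof -
    let ?S' = "m + 2 ^ jv"
    have mk: "m < 2 ^ (k + 2)" "?S' < 2 ^ (k + 2)" "m < 2 ^ w" "Suc m < 2 ^ w"
    proof -
      have "(2::nat) ^ (k + 2) = 4 * 2 ^ k" "(2::nat) ^ (k + 1) = 2 * 2 ^ k" by simp_all
      then show "m < 2 ^ (k + 2)" "?S' < 2 ^ (k + 2)" "m < 2 ^ w" "Suc m < 2 ^ w"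
        using m pH pj pw by linarith+
    qed
    have fr: "regs \<sigma>' 0 = of_bool (b \<or> dst i = t \<and> (\<exists>S<m. ?adm S))"
        "regs \<sigma>' 1 = M" "regs \<sigma>' 2 = s" "regs \<sigma>' 3 = t" "regs \<sigma>' 4 = \<Delta>"
        "regs \<sigma>' 6 = src i" "regs \<sigma>' 7 = dst i" "regs \<sigma>' 8 = ?\<tau>" "regs \<sigma>' 12 = m"
        "mem \<sigma>' (slot_addr (src i)) = ju" "mem \<sigma>' (slot_addr (dst i)) = jv"
      and tab: "table ?\<tau> (Rm m) \<sigma>'"
      using Im slots by (simp_all add: I_def frame_def arc_frame_def)
    define e where "e = current ?\<tau> (mem \<sigma>' (old_addr m ju)) (mem \<sigma>' (new_addr m ju))"
    define e' where "e' = current ?\<tau> (mem \<sigma>' (old_addr ?S' jv)) (mem \<sigma>' (new_addr ?S' jv))"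
    define \<sigma>1 where "\<sigma>1 = \<sigma>'\<lparr>regs := (regs \<sigma>')(13 := old_addr m ju, 14 := old_addr ?S' jv, 15 := e)\<rparr>"
    have 1: "sem w (Assign 13 (addr_expr 2 (cell_expr (Reg 12) (slot_expr 6)))) \<sigma>'
        = \<sigma>'\<lparr>regs := (regs \<sigma>')(13 := old_addr m ju)\<rparr>" (is "_ = ?\<sigma>a")
      using fr uv mk j by (simp add: eval_cell eval_slot)
    have 2: "sem w (Assign 14 (addr_expr 2 (cell_expr (Op Add (Reg 12) (pow2_expr (slot_expr 7))) (slot_expr 7)))) ?\<sigma>a
        = ?\<sigma>a\<lparr>regs := (regs ?\<sigma>a)(14 := old_addr ?S' jv)\<rparr>" (is "_ = ?\<sigma>b")
    proof -
      have p: "eval_expr w (pow2_expr (slot_expr 7)) ?\<sigma>a = 2 ^ jv"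
        by (rule eval_pow2) (use fr uv j in \<open>simp_all add: eval_slot\<close>)
      have "eval_expr w (addr_expr 2 (cell_expr (Op Add (Reg 12) (pow2_expr (slot_expr 7))) (slot_expr 7))) ?\<sigma>a
          = old_addr ?S' jv"
        by (rule eval_cell) (use fr uv mk j pw p in \<open>simp_all add: eval_slot\<close>)
      then show ?thesis by simp
    qed
    have 3: "sem w (current_arrival 15 13) ?\<sigma>b = \<sigma>1"
      by (subst sem_current_arrival[of _ _ m ju]) (use fr mk j in \<open>simp_all add: \<sigma>1_def e_def\<close>)
    have test: "eval_expr w extend_test \<sigma>1 \<noteq> 0 \<longleftrightarrow> ?adm m"
    proof -
      have rep: "represents ?\<tau> (mem \<sigma>' (old_addr m ju)) (mem \<sigma>' (new_addr m ju)) (Rm m m ju)"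
        if "ju \<in> set_decode m"
        using tab j that by (simp add: table_def)
      then have "e \<le> ?\<tau>" if "ju \<in> set_decode m"
        using that by (cases "e = 0") (auto simp: represents_def e_def)
      \<comment> \<open>If the mask lacks \<open>ju\<close>, the entry may be garbage and the sum
        may wrap; the first factor of the test is 0 in that case.\<close>
      then have e: "ju \<in> set_decode m \<Longrightarrow> e + \<Delta> < 2 ^ w"
        using word_nodes input_bound uv by fastforce
      have "eval_expr w extend_test \<sigma>1 \<noteq> 0 \<longleftrightarrow> ju \<in> set_decode m \<and> jv \<notin> set_decode m \<and>
          (src i = s \<and> m = 2 ^ ju \<or> 0 < e \<and> ?\<tau> \<le> e + \<Delta>)"
        by (subst eval_extend_test[of _ "src i" "dst i" ?\<tau> ju jv])
          (use fr uv mk j e in \<open>simp_all add: \<sigma>1_def\<close>)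
      also have "\<dots> \<longleftrightarrow> ?adm m"
      proof (cases "ju \<in> set_decode m \<and> jv \<notin> set_decode m")
        case True
        then have "Rm m m ju = R m ju" by (auto simp: Rm_def)
        then show ?thesis
          using represents_usable[of ?\<tau> _ _ "R m ju" \<Delta>] rep True by (auto simp: admits_def e_def)
      qed (auto simp: admits_def)
      finally show ?thesis .
    qed
    define \<sigma>2 where "\<sigma>2 = (if ?adm m then \<sigma>1\<lparr>
        regs := (regs \<sigma>1)(16 := e', 0 := if dst i = t then 1 else regs \<sigma>' 0),
        mem := (mem \<sigma>')(old_addr ?S' jv := e', new_addr ?S' jv := Suc ?\<tau>)\<rparr> else \<sigma>1)"
    have 4: "sem w (If extend_test (Seq (current_arrival 16 14) (Seq (Store (Reg 14) (Reg 16))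
            (Seq (Store (Op Add (Reg 14) (Const 1)) (Op Add (Reg 8) (Const 1)))
                 (If (Op Equal (Reg 7) (Reg 3)) (Assign 0 (Const 1)) Skip)))) Skip) \<sigma>1 = \<sigma>2"
    proof (cases "?adm m")
      case True
      have "sem w (current_arrival 16 14) \<sigma>1 = \<sigma>1\<lparr>regs := (regs \<sigma>1)(16 := e')\<rparr>"
        by (subst sem_current_arrival[of _ _ ?S' jv]) (use fr mk j in \<open>simp_all add: \<sigma>1_def e'_def\<close>)
      moreover have "Suc ?\<tau> < 2 ^ w" using uv word_nodes by linarith
      ultimately show ?thesis
        using True test mk j fr by (simp add: \<sigma>2_def \<sigma>1_def fun_eq_iff)
    next
      case False
      then show ?thesis using test by (simp add: \<sigma>2_def)
    qed
    have final: "sem w extend_body \<sigma>' = \<sigma>2\<lparr>regs := (regs \<sigma>2)(12 := Suc m)\<rparr>"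
    proof -
      have "regs \<sigma>2 12 = m" using fr by (simp add: \<sigma>2_def \<sigma>1_def)
      then show ?thesis
        unfolding extend_body_def sem.simps(4) 1 2 3 4 using mk by (simp add: incr_def)
    qed
    have "table ?\<tau> (Rm (Suc m)) \<sigma>2"
      unfolding table_def
    proof (intro allI impI)
      fix S l assume l: "l \<le> 2 * M" "l \<in> set_decode S"
      have old: "represents ?\<tau> (mem \<sigma>' (old_addr S l)) (mem \<sigma>' (new_addr S l)) (Rm m S l)"
        using tab l by (simp add: table_def)
      show "represents ?\<tau> (mem \<sigma>2 (old_addr S l)) (mem \<sigma>2 (new_addr S l)) (Rm (Suc m) S l)"
      proof (cases "?adm m \<and> S = ?S' \<and> l = jv")
        case True
        then have eq: "Rm m S l = R S l" "Rm (Suc m) S l = insert (Suc ?\<tau>) (R S l)"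
          using l by (simp_all add: Rm_def)
        have mm: "mem \<sigma>2 (old_addr S l) = e'" "mem \<sigma>2 (new_addr S l) = Suc ?\<tau>"
          using True by (simp_all add: \<sigma>2_def)
        show ?thesis
          using represents_insert[OF old[unfolded eq(1)]] True unfolding eq(2) mm by (simp add: e'_def)
      next
        case False
        \<comment> \<open>Masks containing \<open>jv\<close> are determined by their sources, so the
          step affects just one entry.\<close>
        have "S - 2 ^ jv \<noteq> m" if "l = jv" "?adm m"
        proof
          assume "S - 2 ^ jv = m"
          then have "S = ?S'" using set_decode_diff_power(1)[of jv S] that(1) l(2) by simp
          then show False using False that by simp
        qed
        then have "Rm (Suc m) S l = Rm m S l" by (auto simp: Rm_def less_Suc_eq)
        moreover have "mem \<sigma>2 (old_addr S l) = mem \<sigma>' (old_addr S l)" "mem \<sigma>2 (new_addr S l) = mem \<sigma>' (new_addr S l)"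
          using False l j by (auto simp: \<sigma>2_def \<sigma>1_def)
        ultimately show ?thesis using old by simp
      qed
    qed
    moreover have "arc_frame lst slt occ H (b \<or> dst i = t \<and> (\<exists>S<Suc m. ?adm S)) i \<sigma>2"
      using Im unfolding I_def frame_def arc_frame_def
      by (simp add: \<sigma>2_def \<sigma>1_def less_Suc_eq ex_disj_distrib conj_disj_distribR)
    ultimately have "I (Suc m) (sem w extend_body \<sigma>')"
      unfolding final by (simp add: I_def)
    then show ?thesis
      using extend_body_cost by (intro runs_loop_free)
  qed
  have 1: "runs w (Assign 12 (Const 0)) \<sigma> 2 (I 0)"
    using assms(1,2) by (intro runs_loop_free) (auto simp: I_def Rm_def frame_defs)
  have 2: "runs w (While (Op Less (Reg 12) (pow2_expr (Reg 9))) extend_body) \<sigma>'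
      (2 ^ H * (1 + expr_cost (Op Less (Reg 12) (pow2_expr (Reg 9))) + 250)
        + (1 + expr_cost (Op Less (Reg 12) (pow2_expr (Reg 9))))) (I (2 ^ H))" if "I 0 \<sigma>'" for \<sigma>'
  proof (rule runs_While[of I, OF that])
    show "eval_expr w (Op Less (Reg 12) (pow2_expr (Reg 9))) \<sigma>'' \<noteq> 0 \<and> runs w extend_body \<sigma>'' 250 (I (Suc m))"
      if "m < 2 ^ H" "I m \<sigma>''" for m \<sigma>''
      using step[OF that] ev[OF that(2)] that by (simp add: I_def)
    show "eval_expr w (Op Less (Reg 12) (pow2_expr (Reg 9))) \<sigma>'' = 0" if "I (2 ^ H) \<sigma>''" for \<sigma>''
      using ev[OF that] that by (simp add: I_def)
  qed
  have fin: "(\<exists>S<2 ^ H. ?adm S) \<longleftrightarrow> (\<exists>S. ?adm S)" "Rm (2 ^ H) = extended i R ju jv"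
    using adm_less by (auto simp: Rm_def extended_def fun_eq_iff)
  show ?thesis
    unfolding extend_def
    by (rule runs_mono[OF runs_Seq[OF 1 2]]) (use pH in \<open>auto simp: I_def fin\<close>)
qed

section \<open>Releasing a slot\<close>

text \<open>Entries of masks containing \<open>J\<close> must end up empty, as the slot will be
  given to another node.\<close>

definition released :: "nat \<Rightarrow> (nat \<Rightarrow> nat \<Rightarrow> nat set) \<Rightarrow> nat \<Rightarrow> nat \<Rightarrow> nat set" where
  "released J R S j = (if J \<in> set_decode S then {} else R S j \<union> R (S + 2 ^ J) j)"

lemma merge_body_cost: "loop_free merge_body" "max_cost merge_body \<le> 250"
  by (simp_all add: merge_body_def current_arrival_def incr_def)

lemma runs_merge:
  assumes "arc_frame lst slt occ H b i \<sigma>" "table (tm i) R \<sigma>" "regs \<sigma> 11 = J" "J < H" "H \<le> k + 1"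
    and R: "bounded H R"
  shows "runs w merge \<sigma> (H * 2 ^ H * 300 + 30) (\<lambda>\<sigma>'.
     arc_frame lst slt occ H b i \<sigma>' \<and> table (tm i) (released J R) \<sigma>' \<and> regs \<sigma>' 11 = J)"
proof -
  let ?\<tau> = "tm i" and ?g = "Op Less (Reg 12) (Op Mul (Reg 9) (pow2_expr (Reg 9)))"
  \<comment> \<open>The pair of a mask without \<open>J\<close> and a slot has position
    \<open>S * H + j\<close>; a mask with \<open>J\<close> is cleared when its partner
    \<open>S - 2 ^ J\<close> is treated.\<close>
  define Rm where "Rm = (\<lambda>m S j. if J \<in> set_decode S
      then if j < H \<and> (S - 2 ^ J) * H + j < m then {} else R S j
      else if j < H \<and> S * H + j < m then R S j \<union> R (S + 2 ^ J) j else R S j)"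
  define I where "I = (\<lambda>m \<sigma>'. arc_frame lst slt occ H b i \<sigma>' \<and>
      table ?\<tau> (Rm m) \<sigma>' \<and> regs \<sigma>' 11 = J \<and> regs \<sigma>' 12 = m)"
  have pH: "(2::nat) ^ H \<le> 2 ^ (k + 1)" using assms(5) by (intro power_increasing) auto
  have pJ: "(2::nat) ^ J \<le> 2 ^ k" using assms(4,5) by (intro power_increasing) auto
  have pw: "(2::nat) ^ (k + 2) < 2 ^ w" by (rule mask_less) simp
  have HH: "H * 2 ^ H < 2 ^ w"
  proof -
    have "H * 2 ^ H \<le> (k + 1) * 2 ^ (k + 1)" using pH assms(5) by (intro mult_mono) auto
    then show ?thesis using word_masks by linarith
  qed
  have ev: "eval_expr w ?g \<sigma>' = of_bool (m < H * 2 ^ H)" if "I m \<sigma>'" for m \<sigma>'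
  proof -
    have "eval_expr w (pow2_expr (Reg 9)) \<sigma>' = 2 ^ H"
      by (rule eval_pow2) (use that assms(5) in \<open>auto simp: I_def frame_defs\<close>)
    then show ?thesis using that HH by (simp add: I_def frame_defs)
  qed
  have step: "runs w merge_body \<sigma>' 250 (I (Suc m))" if m: "m < H * 2 ^ H" and Im: "I m \<sigma>'" for m \<sigma>'
  proof -
    define S0 where "S0 = m div H"
    define j0 where "j0 = m mod H"
    let ?S' = "S0 + 2 ^ J"
    have S0: "S0 < 2 ^ H" using m by (simp add: S0_def less_mult_imp_div_less mult.commute)
    have j0: "j0 < H" using assms(4) by (simp add: j0_def)
    then have "j0 \<le> 2 * M" using assms(5) width_le by linarith
    note j0 = j0 this
    have mdef: "S0 * H + j0 = m" by (simp add: S0_def j0_def)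
    have uniq: "S = S0 \<and> l = j0" if "S * H + l = m" "l < H" for S l
      using that by (auto simp: S0_def j0_def)
    have mk: "S0 < 2 ^ (k + 2)" "?S' < 2 ^ (k + 2)" "S0 < 2 ^ w" "Suc m < 2 ^ w" "j0 < 2 ^ w" "?S' < 2 ^ w"
    proof -
      have "(2::nat) ^ (k + 2) = 4 * 2 ^ k" "(2::nat) ^ (k + 1) = 2 * 2 ^ k" by simp_all
      moreover have "j0 \<le> m" by (simp add: j0_def)
      ultimately show "S0 < 2 ^ (k + 2)" "?S' < 2 ^ (k + 2)" "S0 < 2 ^ w" "Suc m < 2 ^ w" "j0 < 2 ^ w" "?S' < 2 ^ w"
        using S0 pH pJ pw m HH by linarith+
    qed
    have fr: "regs \<sigma>' 1 = M" "regs \<sigma>' 8 = ?\<tau>" "regs \<sigma>' 9 = H" "regs \<sigma>' 11 = J" "regs \<sigma>' 12 = m"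
      and tab: "table ?\<tau> (Rm m) \<sigma>'"
      using Im by (simp_all add: I_def frame_def arc_frame_def)
    have quot: "eval_expr w (Op Quot (Reg 12) (Reg 9)) \<rho> = S0" "eval_expr w (Op Rem (Reg 12) (Reg 9)) \<rho> = j0"
      if "regs \<rho> 12 = m" "regs \<rho> 9 = H" for \<rho>
      using that mk by (simp_all add: S0_def[symmetric] j0_def[symmetric])
    have bit: "eval_expr w (bit_expr (Op Quot (Reg 12) (Reg 9)) (Reg 11)) \<sigma>' = of_bool (J \<in> set_decode S0)"
      by (rule eval_bit) (use quot fr mk in simp_all)
    define e where "e = current ?\<tau> (mem \<sigma>' (old_addr S0 j0)) (mem \<sigma>' (new_addr S0 j0))"
    define e' where "e' = current ?\<tau> (mem \<sigma>' (old_addr ?S' j0)) (mem \<sigma>' (new_addr ?S' j0))"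
    define n where "n = mem \<sigma>' (new_addr S0 j0)"
    define n' where "n' = mem \<sigma>' (new_addr ?S' j0)"
    define \<sigma>1 where "\<sigma>1 = \<sigma>'\<lparr>
        regs := (regs \<sigma>')(13 := old_addr S0 j0, 14 := old_addr ?S' j0, 15 := max e e', 16 := e'),
        mem := (mem \<sigma>')(old_addr S0 j0 := max e e', new_addr S0 j0 := max n n', new_addr ?S' j0 := 0)\<rparr>"
    define \<sigma>2 where "\<sigma>2 = (if J \<in> set_decode S0 then \<sigma>' else \<sigma>1)"
    have 1: "sem w (Assign 13 (addr_expr 2 (cell_expr (Op Quot (Reg 12) (Reg 9)) (Op Rem (Reg 12) (Reg 9))))) \<sigma>'
        = \<sigma>'\<lparr>regs := (regs \<sigma>')(13 := old_addr S0 j0)\<rparr>" (is "_ = ?\<sigma>a")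
      using eval_cell[OF fr(1) quot(1)[OF fr(5,3)] quot(2)[OF fr(5,3)] mk(1) j0(2)] by simp
    have 2: "sem w (Assign 14 (addr_expr 2 (cell_expr (Op Add (Op Quot (Reg 12) (Reg 9)) (pow2_expr (Reg 11)))
               (Op Rem (Reg 12) (Reg 9))))) ?\<sigma>a
        = ?\<sigma>a\<lparr>regs := (regs ?\<sigma>a)(14 := old_addr ?S' j0)\<rparr>" (is "_ = ?\<sigma>b")
    proof -
      have p: "eval_expr w (pow2_expr (Reg 11)) ?\<sigma>a = 2 ^ J"
        by (rule eval_pow2) (use fr assms(4,5) in simp_all)
      have q: "eval_expr w (Op Quot (Reg 12) (Reg 9)) ?\<sigma>a = S0" "eval_expr w (Op Rem (Reg 12) (Reg 9)) ?\<sigma>a = j0"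
        by (rule quot; use fr in simp)+
      have "eval_expr w (Op Add (Op Quot (Reg 12) (Reg 9)) (pow2_expr (Reg 11))) ?\<sigma>a = ?S'"
        unfolding eval_expr.simps(4)[of _ _ "Op Quot (Reg 12) (Reg 9)"] p q using mk by simp
      from eval_cell[OF _ this q(2) mk(2) j0(2)] show ?thesis using fr by simp
    qed
    have 3: "sem w (current_arrival 15 13) ?\<sigma>b = ?\<sigma>b\<lparr>regs := (regs ?\<sigma>b)(15 := e)\<rparr>" (is "_ = ?\<sigma>c")
      by (subst sem_current_arrival[of _ _ S0 j0]) (use fr mk j0 in \<open>simp_all add: e_def\<close>)
    have 4: "sem w (current_arrival 16 14) ?\<sigma>c = ?\<sigma>c\<lparr>regs := (regs ?\<sigma>c)(16 := e')\<rparr>" (is "_ = ?\<sigma>d")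
      by (subst sem_current_arrival[of _ _ ?S' j0]) (use fr mk j0 in \<open>simp_all add: e'_def\<close>)
    have neq: "S0 \<noteq> ?S'" by simp
    have 5: "sem w (Seq (If (Op Less (Reg 15) (Reg 16)) (Assign 15 (Reg 16)) Skip)
       (Seq (Store (Reg 13) (Reg 15))
       (Seq (If (Op Less (Load (Op Add (Reg 13) (Const 1))) (Load (Op Add (Reg 14) (Const 1))))
               (Store (Op Add (Reg 13) (Const 1)) (Load (Op Add (Reg 14) (Const 1)))) Skip)
            (Store (Op Add (Reg 14) (Const 1)) (Const 0))))) ?\<sigma>d = \<sigma>1"
      using mk j0 neq by (auto simp: \<sigma>1_def n_def n'_def fun_eq_iff max_def)
    have final: "sem w merge_body \<sigma>' = \<sigma>2\<lparr>regs := (regs \<sigma>2)(12 := Suc m)\<rparr>"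
    proof -
      have r12: "regs \<sigma>2 12 = m" using fr by (simp add: \<sigma>2_def \<sigma>1_def)
      show ?thesis
      proof (cases "J \<in> set_decode S0")
        case True
        then show ?thesis
          using r12 mk unfolding merge_body_def sem.simps(4,5) bit by (simp add: incr_def \<sigma>2_def)
      next
        case False
        then have "\<sigma>2 = \<sigma>1" by (simp add: \<sigma>2_def)
        then show ?thesis
          unfolding merge_body_def sem.simps(4)[of _ _ "incr _"] sem.simps(5) bit
          using r12 mk False
          unfolding sem.simps(4)[of _ "Assign _ _"] 1 2 sem.simps(4)[of _ "current_arrival _ _"] 3 4 5
          by (simp add: incr_def)
      qed
    qed
    have "table ?\<tau> (Rm (Suc m)) \<sigma>2"
      unfolding table_def
    proof (intro allI impI)
      fix S l assume l: "l \<le> 2 * M" "l \<in> set_decode S"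
      have old: "represents ?\<tau> (mem \<sigma>' (old_addr S l)) (mem \<sigma>' (new_addr S l)) (Rm m S l)" if "l \<in> set_decode S" for S
        using tab l(1) that by (simp add: table_def)
      consider (keep) "J \<notin> set_decode S0" "S = S0" "l = j0" | (clear) "J \<notin> set_decode S0" "S = ?S'" "l = j0"
        | (other) "J \<in> set_decode S0 \<or> l \<noteq> j0 \<or> S \<noteq> S0 \<and> S \<noteq> ?S'" by blast
      then show "represents ?\<tau> (mem \<sigma>2 (old_addr S l)) (mem \<sigma>2 (new_addr S l)) (Rm (Suc m) S l)"
      proof cases
        case keep
        have dec: "set_decode ?S' = insert J (set_decode S0)" by (rule set_decode_add_power[OF keep(1)])
        have eq: "Rm m S0 l = R S0 l" "Rm m ?S' l = R ?S' l" "Rm (Suc m) S l = R S0 l \<union> R ?S' l"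
          using keep mdef j0 dec by (auto simp: Rm_def)
        have mm: "mem \<sigma>2 (old_addr S l) = max e e'" "mem \<sigma>2 (new_addr S l) = max n n'"
          using keep j0 by (simp_all add: \<sigma>2_def \<sigma>1_def)
        show ?thesis
          using represents_union[OF old[of S0] old[of ?S']] l keep dec
          unfolding eq mm by (simp add: e_def e'_def n_def n'_def)
      next
        case clear
        have dec: "set_decode ?S' = insert J (set_decode S0)" by (rule set_decode_add_power[OF clear(1)])
        have "Rm (Suc m) S l = {}" using clear mdef j0 dec by (simp add: Rm_def)
        moreover have "mem \<sigma>2 (new_addr S l) = 0" using clear by (simp add: \<sigma>2_def \<sigma>1_def)
        ultimately show ?thesis by (simp add: represents_empty)
      next
        case other
        have "Rm (Suc m) S l = Rm m S l"
        proof (cases "l < H")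
          case True
          have "(S - 2 ^ J) * H + l \<noteq> m" if "J \<in> set_decode S"
          proof
            assume "(S - 2 ^ J) * H + l = m"
            then have eq: "S - 2 ^ J = S0" "l = j0" using uniq True by blast+
            then have "S = ?S'" using set_decode_diff_power(1)[OF that] by linarith
            moreover have "J \<notin> set_decode S0" using set_decode_diff_power(2)[OF that] unfolding eq(1) by simp
            ultimately show False using other eq(2) by blast
          qed
          moreover have "S * H + l \<noteq> m" if "J \<notin> set_decode S"
            using uniq[of S l] True other that by blast
          ultimately show ?thesis by (auto simp: Rm_def less_Suc_eq)
        qed (simp add: Rm_def)
        moreover have "mem \<sigma>2 (old_addr S l) = mem \<sigma>' (old_addr S l)" "mem \<sigma>2 (new_addr S l) = mem \<sigma>' (new_addr S l)"
          using other l(1) j0 by (auto simp: \<sigma>2_def \<sigma>1_def)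
        ultimately show ?thesis using old[OF l(2)] by simp
      qed
    qed
    moreover have "arc_frame lst slt occ H b i \<sigma>2" "regs \<sigma>2 11 = J"
      using Im unfolding I_def frame_def arc_frame_def by (simp_all add: \<sigma>2_def \<sigma>1_def)
    ultimately have "I (Suc m) (sem w merge_body \<sigma>')"
      unfolding final by (simp add: I_def)
    then show ?thesis
      using merge_body_cost by (intro runs_loop_free)
  qed
  have 1: "runs w (Assign 12 (Const 0)) \<sigma> 2 (I 0)"
    using assms(1-3) by (intro runs_loop_free) (auto simp: I_def Rm_def frame_defs)
  have 2: "runs w (While ?g merge_body) \<sigma>' (H * 2 ^ H * (1 + expr_cost ?g + 250) + (1 + expr_cost ?g)) (I (H * 2 ^ H))"
    if "I 0 \<sigma>'" for \<sigma>'
  proof (rule runs_While[of I, OF that])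
    show "eval_expr w ?g \<sigma>'' \<noteq> 0 \<and> runs w merge_body \<sigma>'' 250 (I (Suc m))"
      if "m < H * 2 ^ H" "I m \<sigma>''" for m \<sigma>''
      using step[OF that] ev[OF that(2)] that by simp
    show "eval_expr w ?g \<sigma>'' = 0" if "I (H * 2 ^ H) \<sigma>''" for \<sigma>''
      using ev[OF that] by simp
  qed
  \<comment> \<open>Restricted to \<open>j \<in> set_decode S\<close>, the entries that
    \<open>table\<close> constrains; for them \<open>bounded\<close> rules out content beyond the
    loop.\<close>
  have fin: "Rm (H * 2 ^ H) S j = released J R S j" if "j \<in> set_decode S" for S j
  proof -
    have small: "S' * H + j < H * 2 ^ H" if "S' < 2 ^ H" "j < H" for S'
    proof -
      have "S' * H + j < Suc S' * H" using that by simp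
      also have "\<dots> \<le> 2 ^ H * H" using that(1) by (intro mult_right_mono) auto
      finally show ?thesis by (simp add: mult.commute)
    qed
    have bd: "S' < 2 ^ H \<and> j < H" if "R S' j \<noteq> {}" "j \<in> set_decode S'" for S'
      using R that set_decode_subset_lessThan_iff[of S' H] by (auto simp: bounded_def)
    show ?thesis
    proof (cases "J \<in> set_decode S")
      case True
      have "(S - 2 ^ J) * H + j < H * 2 ^ H \<and> j < H" if "R S j \<noteq> {}"
        using small[of "S - 2 ^ J"] bd[OF that \<open>j \<in> set_decode S\<close>] less_imp_diff_less by blast
      then show ?thesis using True by (auto simp: Rm_def released_def)
    next
      case False
      have "j \<in> set_decode (S + 2 ^ J)" using that set_decode_add_power[OF False] by simp
      then have "S < 2 ^ H \<and> j < H" if "R S j \<noteq> {} \<or> R (S + 2 ^ J) j \<noteq> {}"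
        using that bd[of S] bd[of "S + 2 ^ J"] \<open>j \<in> set_decode S\<close> by (meson add_lessD1)
      then have "S * H + j < H * 2 ^ H \<and> j < H" if "R S j \<noteq> {} \<or> R (S + 2 ^ J) j \<noteq> {}"
        using small that by blast
      then show ?thesis using False by (auto simp: Rm_def released_def)
    qed
  qed
  have "table ?\<tau> (Rm (H * 2 ^ H)) \<sigma>' \<longleftrightarrow> table ?\<tau> (released J R) \<sigma>'" for \<sigma>'
    using fin by (auto simp: table_def)
  then show ?thesis
    unfolding merge_def by (intro runs_mono[OF runs_Seq[OF 1 2]]) (auto simp: I_def)
qed

lemma runs_free:
  assumes "arc_frame lst slt occ H b i \<sigma>" "table (tm i) R \<sigma>"
    and "r = 6 \<and> x = src i \<or> r = 7 \<and> x = dst i"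
    and "slt x = J" "J < H" "H \<le> k + 1" "occ < 2 ^ (k + 1)" and R: "bounded H R"
  shows "runs w (free r) \<sigma> (H * 2 ^ H * 300 + 90) (\<lambda>\<sigma>'. if lst x = i \<and> J \<in> set_decode occ
     then arc_frame lst slt (occ - 2 ^ J) H b i \<sigma>' \<and> table (tm i) (released J R) \<sigma>'
     else arc_frame lst slt occ H b i \<sigma>' \<and> table (tm i) R \<sigma>')" (is "runs _ _ _ _ ?Q")
proof -
  let ?g = "Op Mul (Op Equal (Load (addr_expr 0 (node_expr (Reg r)))) (Reg 5)) (bit_expr (Reg 10) (Reg 11))"
  define K where "K = (\<lambda>\<sigma>'. arc_frame lst slt occ H b i \<sigma>' \<and> table (tm i) R \<sigma>' \<and> regs \<sigma>' 11 = J)"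
  have x: "regs \<sigma>' r = x" "x \<le> mx" "regs \<sigma>' 1 = M" if "arc_frame lst slt occ H b i \<sigma>'" for \<sigma>'
    using assms(3) arc_bound that by (auto simp: frame_defs)
  have occ: "occ < 2 ^ w" using assms(7) mask_less[of "k + 1"] by simp
  have 1: "runs w (Assign 11 (slot_expr r)) \<sigma> 11 K"
    using assms(1,2,4) x[OF assms(1)]
    by (intro runs_loop_free) (auto simp: K_def frame_defs eval_slot)
  have ev: "eval_expr w ?g \<sigma>' \<noteq> 0 \<longleftrightarrow> lst x = i \<and> J \<in> set_decode occ" if "K \<sigma>'" for \<sigma>'
  proof -
    have "eval_expr w (addr_expr 0 (node_expr (Reg r))) \<sigma>' = last_addr x"
      by (rule eval_node(1)) (use x that in \<open>auto simp: K_def\<close>)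
    moreover have "eval_expr w (bit_expr (Reg 10) (Reg 11)) \<sigma>' = of_bool (J \<in> set_decode occ)"
      by (rule eval_bit) (use that occ in \<open>auto simp: K_def frame_defs\<close>)
    ultimately show ?thesis using that by (auto simp: K_def frame_defs)
  qed
  have sub: "runs w (Assign 10 (Op Sub (Reg 10) (pow2_expr (Reg 11)))) \<sigma>' 10 ?Q"
    if "arc_frame lst slt occ H b i \<sigma>' \<and> table (tm i) (released J R) \<sigma>' \<and> regs \<sigma>' 11 = J"
      "lst x = i \<and> J \<in> set_decode occ" for \<sigma>'
  proof -
    have "eval_expr w (pow2_expr (Reg 11)) \<sigma>' = 2 ^ J"
      by (rule eval_pow2) (use that assms(5,6) in auto)
    \<comment> \<open>Bit \<open>J\<close> is set in \<open>occ\<close>, so the modular subtraction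
      does not wrap.\<close>
    moreover have "nat ((int occ - int (2 ^ J)) mod 2 ^ w) = occ - 2 ^ J"
    proof -
      have "2 ^ J \<le> occ" using set_decode_diff_power that by auto
      then have "int occ - int (2 ^ J) = int (occ - 2 ^ J)" by simp
      moreover have "int (occ - 2 ^ J) mod 2 ^ w = int (occ - 2 ^ J)"
        using occ by (metis less_imp_diff_less mod_less of_nat_numeral of_nat_power zmod_int)
      ultimately show ?thesis by (metis nat_int)
    qed
    ultimately show ?thesis
      using that by (intro runs_loop_free) (auto simp: frame_defs)
  qed
  have 2: "runs w (If ?g (Seq merge (Assign 10 (Op Sub (Reg 10) (pow2_expr (Reg 11))))) Skip) \<sigma>'
      (1 + expr_cost ?g + (1 + (H * 2 ^ H * 300 + 30) + 10)) ?Q" if K: "K \<sigma>'" for \<sigma>'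
  proof (rule runs_If)
    assume "eval_expr w ?g \<sigma>' \<noteq> 0"
    then have c: "lst x = i \<and> J \<in> set_decode occ" using ev[OF K] by simp
    show "runs w (Seq merge (Assign 10 (Op Sub (Reg 10) (pow2_expr (Reg 11))))) \<sigma>' (1 + (H * 2 ^ H * 300 + 30) + 10) ?Q"
      by (rule runs_Seq[OF runs_merge[where J = J] sub])
        (use K assms(5,6) R c in \<open>auto simp: K_def\<close>)
  next
    assume "eval_expr w ?g \<sigma>' = 0"
    then have "\<not> (lst x = i \<and> J \<in> set_decode occ)" using ev[OF K] by blast
    then show "runs w Skip \<sigma>' (1 + (H * 2 ^ H * 300 + 30) + 10) ?Q"
      using K by (intro runs_loop_free) (auto simp: K_def)
  qed
  show ?thesis
    unfolding free_def by (rule runs_mono[OF runs_Seq[OF 1 2]]) auto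
qed

section \<open>The table as a projection of the reachable configurations\<close>

text \<open>The ideal table contents: configurations are identified when they agree on
  \<open>A\<close>, and those ending outside \<open>A\<close> are dropped.\<close>

definition projection :: "nat \<Rightarrow> nat set \<Rightarrow> (nat \<Rightarrow> nat) \<Rightarrow> nat \<Rightarrow> nat \<Rightarrow> nat set" where
  "projection n A slt S j =
     {a. \<exists>X v. (X, v, a) \<in> reach n \<and> v \<in> A \<and> slt v = j \<and> S = set_encode (slt ` (X \<inter> A))}"

text \<open>Injectivity extends to \<open>N\<close> so that the slot of an endpoint of the current
  arc stays distinguishable after its release. The 0 in \<open>occ\<close> is the reserved
  slot.\<close>

definition allocation :: "nat set \<Rightarrow> nat set \<Rightarrow> (nat \<Rightarrow> nat) \<Rightarrow> nat \<Rightarrow> nat \<Rightarrow> bool" where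
  "allocation A N slt occ H \<longleftrightarrow> finite A \<and> inj_on slt (A \<union> N) \<and> slt ` (A \<union> N) \<subseteq> {1..<H} \<and>
     1 \<le> H \<and> H \<le> k + 1 \<and> set_decode occ = insert 0 (slt ` A)"

lemma allocation_occ: "allocation A N slt occ H \<Longrightarrow> occ < 2 ^ (k + 1)"
  by (rule iffD1[OF set_decode_subset_lessThan_iff]) (fastforce simp: allocation_def)

lemma decode_projection:
  assumes "allocation A N slt occ H"
  shows "set_decode (set_encode (slt ` (X \<inter> A))) = slt ` (X \<inter> A)"
  using assms by (simp add: allocation_def)

lemma slot_in_iff:
  assumes "allocation A N slt occ H" "x \<in> A"
  shows "slt x \<in> slt ` (X \<inter> A) \<longleftrightarrow> x \<in> X"
  using assms by (auto simp: allocation_def inj_on_def)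

lemma projection_bounded:
  assumes "allocation A N slt occ H"
  shows "bounded H (projection n A slt)"
proof -
  have "S < 2 ^ H" if "S = set_encode (slt ` (X \<inter> A))" for S X
  proof -
    have "set_decode S \<subseteq> {..<H}"
      using assms unfolding that decode_projection[OF assms] by (auto simp: allocation_def)
    then show ?thesis by (simp add: set_decode_subset_lessThan_iff)
  qed
  then show ?thesis by (auto simp: bounded_def projection_def)
qed

text \<open>An unseen node occurs in no configuration, so giving it a slot changes no entry.\<close>

lemma projection_alloc:
  assumes "x \<notin> seen n"
  shows "projection n (insert x A) (slt(x := j)) = projection n A slt"
proof -
  have eq: "(X, v, a) \<in> reach n \<and> v \<in> insert x A \<and> (slt(x := j)) v = l \<and>
        S = set_encode ((slt(x := j)) ` (X \<inter> insert x A)) \<longleftrightarrow>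
      (X, v, a) \<in> reach n \<and> v \<in> A \<and> slt v = l \<and> S = set_encode (slt ` (X \<inter> A))" for X v a l S
  proof (cases "(X, v, a) \<in> reach n")
    case True
    then have x: "x \<notin> X" "v \<noteq> x" using reach_props[OF True] assms by auto
    have "(slt(x := j)) ` (X \<inter> insert x A) = slt ` (X \<inter> A)"
      using x by (intro image_cong) auto
    then show ?thesis using x by simp
  qed simp
  show ?thesis unfolding projection_def fun_eq_iff eq by simp
qed

text \<open>Since \<open>slt\<close> is injective on \<open>A\<close> and both endpoints lie in
  \<open>A\<close>, the bits of the mask decide exactly whether they were visited, although the mask
  forgets nodes outside \<open>A\<close>.\<close>

lemma admits_projection:
  assumes "allocation A N slt occ H" "src i \<in> A" "dst i \<in> A"
  shows "admits i (projection i A slt) (slt (src i)) (slt (dst i)) S \<longleftrightarrow>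
    (\<exists>X. extendable i X \<and> S = set_encode (slt ` (X \<inter> A)))"
proof
  assume l: "admits i (projection i A slt) (slt (src i)) (slt (dst i)) S"
  show "\<exists>X. extendable i X \<and> S = set_encode (slt ` (X \<inter> A))"
  proof (cases "src i = s \<and> S = 2 ^ slt (src i)")
    case True
    have S: "S = set_encode (slt ` ({s} \<inter> A))" using True assms(2) by (simp add: set_encode_def)
    have "slt (dst i) \<notin> set_decode S" using l by (simp add: admits_def)
    then have "dst i \<notin> {s}" unfolding S decode_projection[OF assms(1)] using assms(3) by auto
    then show ?thesis using True S by (intro exI[of _ "{s}"]) (auto simp: extendable_def)
  next
    case False
    then obtain a where a: "a \<in> projection i A slt S (slt (src i))" "a \<le> tm i" "tm i \<le> a + \<Delta>"
      using l by (auto simp: admits_def)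
    then obtain X v where X: "(X, v, a) \<in> reach i" "v \<in> A" "slt v = slt (src i)" "S = set_encode (slt ` (X \<inter> A))"
      by (auto simp: projection_def)
    have v: "v = src i" using assms(1,2) X(2,3) by (auto simp: allocation_def inj_on_def)
    have "slt (dst i) \<notin> set_decode S" using l by (simp add: admits_def)
    then have "dst i \<notin> X" unfolding X(4) decode_projection[OF assms(1)] using assms(3) by auto
    then show ?thesis using X a v by (auto simp: extendable_def)
  qed
next
  assume "\<exists>X. extendable i X \<and> S = set_encode (slt ` (X \<inter> A))"
  then obtain X where X: "extendable i X" "S = set_encode (slt ` (X \<inter> A))" by auto
  have "src i \<in> X" "dst i \<notin> X" using X(1) reach_props by (auto simp: extendable_def)
  then have "slt (src i) \<in> set_decode S" "slt (dst i) \<notin> set_decode S"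
    unfolding X(2) decode_projection[OF assms(1)] using slot_in_iff[OF assms(1)] assms(2,3) by auto
  moreover have "src i = s \<and> S = 2 ^ slt (src i) \<or>
      (\<exists>a\<in>projection i A slt S (slt (src i)). a \<le> tm i \<and> tm i \<le> a + \<Delta>)"
  proof (cases "src i = s \<and> X = {s}")
    case True
    then have "S = 2 ^ slt (src i)" using X(2) assms(2) by (simp add: set_encode_def)
    then show ?thesis using True by simp
  next
    case False
    then show ?thesis using X assms(2) by (auto simp: extendable_def projection_def)
  qed
  ultimately show "admits i (projection i A slt) (slt (src i)) (slt (dst i)) S"
    by (simp add: admits_def)
qed

text \<open>The head is unvisited, so visiting it adds exactly \<open>2 ^ slt (dst i)\<close> to the
  mask.\<close>

lemma extended_projection:
  assumes "allocation A N slt occ H" "src i \<in> A" "dst i \<in> A"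
  shows "extended i (projection i A slt) (slt (src i)) (slt (dst i)) = projection (Suc i) A slt"
proof (intro ext)
  fix S j
  let ?jv = "slt (dst i)"
  have enc: "set_encode (slt ` (insert (dst i) X \<inter> A)) = 2 ^ ?jv + set_encode (slt ` (X \<inter> A))"
    if "extendable i X" for X
  proof -
    have "?jv \<notin> slt ` (X \<inter> A)"
      using slot_in_iff[OF assms(1,3)] that by (simp add: extendable_def)
    moreover have "insert (dst i) X \<inter> A = insert (dst i) (X \<inter> A)" using assms(3) by auto
    ultimately show ?thesis using assms(1) by (simp add: allocation_def)
  qed
  have new: "(\<exists>X. extendable i X \<and> S = set_encode (slt ` (insert (dst i) X \<inter> A))) \<longleftrightarrow>
      ?jv \<in> set_decode S \<and> admits i (projection i A slt) (slt (src i)) ?jv (S - 2 ^ ?jv)"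
    unfolding admits_projection[OF assms]
  proof
    assume "\<exists>X. extendable i X \<and> S = set_encode (slt ` (insert (dst i) X \<inter> A))"
    then obtain X where X: "extendable i X" "S = set_encode (slt ` (insert (dst i) X \<inter> A))" by auto
    have "?jv \<in> set_decode S" unfolding X(2) decode_projection[OF assms(1)] using assms(3) by auto
    moreover have "S - 2 ^ ?jv = set_encode (slt ` (X \<inter> A))" using X enc by simp
    ultimately show "?jv \<in> set_decode S \<and> (\<exists>X. extendable i X \<and> S - 2 ^ ?jv = set_encode (slt ` (X \<inter> A)))"
      using X(1) by auto
  next
    assume "?jv \<in> set_decode S \<and> (\<exists>X. extendable i X \<and> S - 2 ^ ?jv = set_encode (slt ` (X \<inter> A)))"
    then show "\<exists>X. extendable i X \<and> S = set_encode (slt ` (insert (dst i) X \<inter> A))"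
      using enc set_decode_diff_power(1)[of ?jv S] by (metis le_add_diff_inverse)
  qed
  have "projection (Suc i) A slt S j = projection i A slt S j \<union>
      {a. a = Suc (tm i) \<and> ?jv = j \<and> (\<exists>X. extendable i X \<and> S = set_encode (slt ` (insert (dst i) X \<inter> A)))}"
    unfolding projection_def reach_Suc using assms(3) by blast
  also have "\<dots> = extended i (projection i A slt) (slt (src i)) ?jv S j"
    unfolding new by (auto simp: extended_def)
  finally show "extended i (projection i A slt) (slt (src i)) ?jv S j = projection (Suc i) A slt S j" by simp
qed

text \<open>After \<open>x\<close> is forgotten, a mask stands for the paths that avoided
  \<open>x\<close> and those that visited it. If the mask lacks the slot of \<open>x\<close>, then
  \<open>j \<in> set_decode S\<close> ensures that no configuration ending in \<open>x\<close>
  itself is counted.\<close>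

lemma released_projection:
  assumes "allocation A N slt occ H" "x \<in> A" "j \<in> set_decode S"
  shows "released (slt x) (projection n A slt) S j = projection n (A - {x}) slt S j"
proof -
  let ?J = "slt x"
  have fin: "finite (slt ` (X \<inter> A))" "finite (slt ` (X \<inter> (A - {x})))" for X
    using assms(1) by (auto simp: allocation_def)
  have minus: "slt ` (X \<inter> (A - {x})) = slt ` (X \<inter> A) - {?J}" for X
    using assms(1,2) by (auto simp: allocation_def inj_on_def)
  have enc: "S = set_encode B \<longleftrightarrow> set_decode S = B" if "finite B" for B S
    using that by auto
  \<comment> \<open>Set-theoretic core of the merge: the two disjuncts are the two entries that are
    united.\<close>
  have drop: "D = B - {z} \<longleftrightarrow> D = B \<or> insert z D = B" if "z \<notin> D" for B D and z :: nat
    using that by (cases "z \<in> B") auto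
  show ?thesis
  proof (cases "?J \<in> set_decode S")
    case True
    have "set_decode S = slt ` (X \<inter> A) - {?J}" if "S = set_encode (slt ` (X \<inter> (A - {x})))" for X
      using that fin(2)[of X] minus[of X] by simp
    then have "projection n (A - {x}) slt S j = {}"
      using True unfolding projection_def by blast
    then show ?thesis using True by (simp add: released_def)
  next
    case False
    have "S = set_encode (slt ` (X \<inter> (A - {x}))) \<longleftrightarrow> set_decode S = slt ` (X \<inter> A) - {?J}" for X
      unfolding minus[symmetric] by (rule enc[OF fin(2)])
    then have "S = set_encode (slt ` (X \<inter> (A - {x}))) \<longleftrightarrow>
        S = set_encode (slt ` (X \<inter> A)) \<or> S + 2 ^ ?J = set_encode (slt ` (X \<inter> A))" for X
      unfolding enc[OF fin(1)] set_decode_add_power[OF False] using drop[OF False] by metis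
    moreover have "v \<noteq> x" if "slt v = j" for v using that assms(3) False by auto
    ultimately have "projection n (A - {x}) slt S j = projection n A slt S j \<union> projection n A slt (S + 2 ^ ?J) j"
      by (auto simp: projection_def)
    then show ?thesis using False by (simp add: released_def)
  qed
qed

section \<open>One round of the main loop\<close>

primrec last_incident :: "nat \<Rightarrow> nat \<Rightarrow> nat" where
  "last_incident 0 = (\<lambda>_. 0)"
| "last_incident (Suc n) = (last_incident n)(src n := n, dst n := n)"

lemma last_incident_props:
  "x \<in> seen n \<Longrightarrow> incident (last_incident n x) x \<and> last_incident n x < n \<and>
     (\<forall>q<n. incident q x \<longrightarrow> q \<le> last_incident n x)"
proof (induction n)
  case (Suc n)
  show ?case
  proof (cases "x = src n \<or> x = dst n")
    case True
    then show ?thesis by (auto simp: incident_def)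
  next
    case False
    then have "x \<in> seen n" using Suc.prems by (auto simp: seen_Suc)
    then show ?thesis using Suc.IH False by (auto simp: incident_def less_Suc_eq)
  qed
qed (simp add: seen_def)

text \<open>Reduces the question whether a node dies with arc \<open>i\<close> to a comparison with
  the stored index.\<close>

lemma last_incident_iff:
  assumes "incident i x" "i < M"
  shows "last_incident M x = i \<longleftrightarrow> \<not> (\<exists>q. Suc i \<le> q \<and> q < M \<and> incident q x)"
proof -
  have "x \<in> seen M" using assms by (auto simp: seen_def)
  note l = last_incident_props[OF this]
  show ?thesis
  proof
    assume "last_incident M x = i"
    then show "\<not> (\<exists>q. Suc i \<le> q \<and> q < M \<and> incident q x)" using l by fastforce
  next
    assume "\<not> (\<exists>q. Suc i \<le> q \<and> q < M \<and> incident q x)"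
    then have "\<not> Suc i \<le> last_incident M x" using l by blast
    moreover have "i \<le> last_incident M x" using l assms by blast
    ultimately show "last_incident M x = i" by simp
  qed
qed

definition target_reached :: "nat \<Rightarrow> bool" where
  "target_reached n \<longleftrightarrow> s = t \<or> (\<exists>X a. (X, t, a) \<in> reach n)"

text \<open>In round \<open>i\<close>: \<open>Z\<close> are the nodes that ever got a slot, \<open>A\<close> those that hold one, \<open>N\<close> the
  endpoints of arc \<open>i\<close> treated so far, and \<open>n\<close> arcs have been used to extend paths.\<close>

definition round :: "nat set \<Rightarrow> nat set \<Rightarrow> nat set \<Rightarrow> nat \<Rightarrow> nat \<Rightarrow> state \<Rightarrow> bool" where
  "round Z A N i n \<sigma> \<longleftrightarrow> (\<exists>slt occ H. allocation A N slt occ H \<and> (\<forall>x. slt x = 0 \<longleftrightarrow> x \<notin> Z) \<and>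
     arc_frame (last_incident M) slt occ H (target_reached n) i \<sigma> \<and> table (tm i) (projection n A slt) \<sigma>)"

lemma runs_alloc_round:
  assumes "round Z A N i i \<sigma>" "r = 6 \<and> x = src i \<or> r = 7 \<and> x = dst i"
    and "x \<in> A \<longleftrightarrow> x \<in> Z" "seen i \<subseteq> Z" "card (insert x A) \<le> k" "N \<subseteq> A"
  shows "runs w (alloc r) \<sigma> (10 * k + 60) (round (insert x Z) (insert x A) (insert x N) i i)"
proof -
  obtain slt occ H where al: "allocation A N slt occ H" and z: "\<forall>y. slt y = 0 \<longleftrightarrow> y \<notin> Z"
    and fr: "arc_frame (last_incident M) slt occ H (target_reached i) i \<sigma>"
    and tab: "table (tm i) (projection i A slt) \<sigma>"
    using assms(1) by (auto simp: round_def)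
  \<comment> \<open>Pigeonhole: filling all \<open>k + 1\<close> slots \<open>0\<close> to
    \<open>k\<close>, one of them reserved, would take \<open>k\<close> nodes in \<open>A\<close>,
    yet \<open>x\<close> is still missing from \<open>A\<close>.\<close>
  have free: "\<exists>j\<^sub>0\<le>k. j\<^sub>0 \<notin> set_decode occ" if "slt x = 0"
  proof (rule ccontr)
    assume "\<not> ?thesis"
    then have "{..k} \<subseteq> set_decode occ" by auto
    then have "card {..k} \<le> card (set_decode occ)" by (intro card_mono) auto
    also have "\<dots> \<le> Suc (card (slt ` A))"
      using al by (simp add: allocation_def card_insert_if)
    also have "card (slt ` A) \<le> card A" using al by (intro card_image_le) (simp add: allocation_def)
    finally have "k \<le> card A" by simp
    moreover have "x \<notin> A" "finite A" using that z assms(3) al by (auto simp: allocation_def)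
    ultimately show False using assms(5) by simp
  qed
  define j\<^sub>0 where "j\<^sub>0 = (SOME j. j \<le> k \<and> j \<notin> set_decode occ)"
  have j0: "slt x = 0 \<Longrightarrow> j\<^sub>0 \<notin> set_decode occ \<and> j\<^sub>0 \<le> k"
    using someI_ex[OF free] by (simp add: j\<^sub>0_def)
  show ?thesis
  proof (rule runs_mono[OF runs_alloc[OF fr tab allocation_occ[OF al] assms(2) j0] order_refl])
    fix \<sigma>'
    assume q: "if slt x = 0
      then \<exists>j\<le>k. j \<notin> set_decode occ \<and> arc_frame (last_incident M) (slt(x := j)) (occ + 2 ^ j) (max H (Suc j))
          (target_reached i) i \<sigma>' \<and> table (tm i) (projection i A slt) \<sigma>'
      else arc_frame (last_incident M) slt occ H (target_reached i) i \<sigma>' \<and> table (tm i) (projection i A slt) \<sigma>'"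
    show "round (insert x Z) (insert x A) (insert x N) i i \<sigma>'"
    proof (cases "slt x = 0")
      case True
      then obtain j where j: "j \<le> k" "j \<notin> set_decode occ"
        "arc_frame (last_incident M) (slt(x := j)) (occ + 2 ^ j) (max H (Suc j)) (target_reached i) i \<sigma>'"
        "table (tm i) (projection i A slt) \<sigma>'"
        using q by auto
      have x: "x \<notin> A" "x \<notin> seen i" using True z assms(3,4) by auto
      have AN: "A \<union> N = A" "insert x A \<union> insert x N = insert x A" using assms(6) by auto
      have jn: "j \<noteq> 0" "j \<notin> slt ` A" using j(2) al by (auto simp: allocation_def)
      have "allocation (insert x A) (insert x N) (slt(x := j)) (occ + 2 ^ j) (max H (Suc j))"
      proof -
        have "inj_on slt A" "\<And>y. y \<in> A \<Longrightarrow> 1 \<le> slt y \<and> slt y < H" "(slt(x := j)) ` A = slt ` A"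
          using al x(1) unfolding allocation_def AN by (auto intro!: image_cong)
        then show ?thesis
          using al x jn j(1) set_decode_add_power[OF j(2)] unfolding allocation_def AN
          by (auto simp: inj_on_def less_max_iff_disj)
      qed
      moreover have "\<forall>y. (slt(x := j)) y = 0 \<longleftrightarrow> y \<notin> insert x Z" using z jn by auto
      ultimately show ?thesis
        using j(3,4) projection_alloc[OF x(2)] unfolding round_def by metis
    next
      case False
      then have "insert x A = A" "insert x Z = Z" "allocation A (insert x N) slt occ H"
        using z assms(3) al by (auto simp: allocation_def insert_absorb)
      then show ?thesis using q False z unfolding round_def by auto
    qed
  qed
qed

lemma target_reached_Suc:
  "target_reached (Suc i) \<longleftrightarrow> target_reached i \<or> dst i = t \<and> (\<exists>X. extendable i X)"
  by (auto simp: target_reached_def reach_Suc)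

lemma runs_extend_round:
  assumes "round Z A N i i \<sigma>" "src i \<in> A" "dst i \<in> A"
  shows "runs w extend \<sigma> (2 ^ (k + 1) * 300 + 30) (round Z A N i (Suc i))"
proof -
  obtain slt occ H where al: "allocation A N slt occ H" and z: "\<forall>y. slt y = 0 \<longleftrightarrow> y \<notin> Z"
    and fr: "arc_frame (last_incident M) slt occ H (target_reached i) i \<sigma>"
    and tab: "table (tm i) (projection i A slt) \<sigma>"
    using assms(1) by (auto simp: round_def)
  have H: "slt (src i) < H" "slt (dst i) < H" "H \<le> k + 1" using al assms(2,3) by (auto simp: allocation_def)
  have "(target_reached i \<or> dst i = t \<and> (\<exists>S. admits i (projection i A slt) (slt (src i)) (slt (dst i)) S))
      = target_reached (Suc i)"
    unfolding admits_projection[OF al assms(2,3)] target_reached_Suc by auto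
  note * = runs_extend[OF fr tab refl refl H projection_bounded[OF al], unfolded this extended_projection[OF al assms(2,3)]]
  show ?thesis
    by (rule runs_mono[OF *]) (use al z in \<open>unfold round_def, blast+\<close>)
qed

lemma runs_free_round:
  assumes "round Z A N i n \<sigma>" "r = 6 \<and> x = src i \<or> r = 7 \<and> x = dst i" "x \<in> N"
  shows "runs w (free r) \<sigma> ((k + 1) * 2 ^ (k + 1) * 300 + 90)
    (round Z (if last_incident M x = i then A - {x} else A) N i n)"
proof -
  obtain slt occ H where al: "allocation A N slt occ H" and z: "\<forall>y. slt y = 0 \<longleftrightarrow> y \<notin> Z"
    and fr: "arc_frame (last_incident M) slt occ H (target_reached n) i \<sigma>"
    and tab: "table (tm i) (projection n A slt) \<sigma>"
    using assms(1) by (auto simp: round_def)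
  have H: "slt x < H" "H \<le> k + 1" using al assms(3) by (auto simp: allocation_def)
  \<comment> \<open>As \<open>x\<close> lies in \<open>N\<close>, injectivity on
    \<open>A \<union> N\<close> prevents its slot from being occupied by another node.\<close>
  have x: "slt x \<in> set_decode occ \<longleftrightarrow> x \<in> A"
  proof
    assume "slt x \<in> set_decode occ"
    moreover have "slt x \<noteq> 0" using al assms(3) by (fastforce simp: allocation_def)
    ultimately obtain y where "y \<in> A" "slt y = slt x" using al by (auto simp: allocation_def)
    then show "x \<in> A" using al assms(3) by (auto simp: allocation_def inj_on_def)
  qed (use al in \<open>simp add: allocation_def\<close>)
  have cost: "H * 2 ^ H * 300 + 90 \<le> (k + 1) * 2 ^ (k + 1) * 300 + 90"
  proof -
    have "(2::nat) ^ H \<le> 2 ^ (k + 1)" using H(2) by (intro power_increasing) auto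
    then have "H * 2 ^ H \<le> (k + 1) * 2 ^ (k + 1)" using H(2) by (intro mult_mono) auto
    then show ?thesis by linarith
  qed
  show ?thesis
  proof (rule runs_mono[OF runs_free[OF fr tab assms(2) refl H allocation_occ[OF al] projection_bounded[OF al]] cost])
    fix \<sigma>'
    assume q: "if last_incident M x = i \<and> slt x \<in> set_decode occ
      then arc_frame (last_incident M) slt (occ - 2 ^ slt x) H (target_reached n) i \<sigma>' \<and>
        table (tm i) (released (slt x) (projection n A slt)) \<sigma>'
      else arc_frame (last_incident M) slt occ H (target_reached n) i \<sigma>' \<and> table (tm i) (projection n A slt) \<sigma>'"
    show "round Z (if last_incident M x = i then A - {x} else A) N i n \<sigma>'"
    proof (cases "last_incident M x = i \<and> x \<in> A")
      case True
      have "slt ` (A - {x}) = slt ` A - {slt x}" using al True by (auto simp: allocation_def inj_on_def)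
      moreover have "slt x \<noteq> 0" using al assms(3) by (fastforce simp: allocation_def)
      moreover have "set_decode (occ - 2 ^ slt x) = set_decode occ - {slt x}"
        using set_decode_diff_power x True by auto
      ultimately have "allocation (A - {x}) N slt (occ - 2 ^ slt x) H"
        using al by (auto simp: allocation_def intro: inj_on_subset)
      moreover have "table (tm i) (projection n (A - {x}) slt) \<sigma>'"
        using q True x released_projection[OF al, of x] by (auto simp: table_def)
      ultimately show ?thesis using q True x z unfolding round_def by auto
    next
      case False
      then have "(if last_incident M x = i then A - {x} else A) = A" by auto
      then show ?thesis using q False x al z unfolding round_def by auto
    qed
  qed
qed

text \<open>The table is still valid for the time \<open>\<tau>\<close> of an earlier round;
  \<open>represents_later\<close> moves it to the time of the next arc. Quantifying
  \<open>\<tau>\<close> also covers the end, where no next arc exists.\<close>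

definition main :: "nat \<Rightarrow> state \<Rightarrow> bool" where
  "main i \<sigma> \<longleftrightarrow> (\<exists>slt occ H \<tau>. allocation (live i) {} slt occ H \<and> (\<forall>x. slt x = 0 \<longleftrightarrow> x \<notin> seen i) \<and>
     frame (last_incident M) slt occ H (target_reached i) i \<sigma> \<and> table \<tau> (projection i (live i) slt) \<sigma> \<and>
     (\<forall>p. i \<le> p \<longrightarrow> p < M \<longrightarrow> \<tau> \<le> tm p))"

lemma runs_arc_body:
  assumes "main i \<sigma>" "i < M"
  shows "runs w arc_body \<sigma> (3500 * (k * 2 ^ k)) (main (Suc i))"
proof -
  let ?u = "src i" and ?v = "dst i"
  define A where "A = insert ?v (insert ?u (live i))"
  define N where "N = insert ?v (insert ?u {})"
  define Z where "Z = insert ?v (insert ?u (seen i))"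
  have finl: "finite (live i)" using finite_seen[of i] by (simp add: live_def)
  have cardA: "card A \<le> k" using width[OF assms(2)] by (simp add: A_def insert_commute)
  have k: "1 \<le> k"
  proof -
    have "0 < card A" using finl by (simp add: A_def card_gt_0_iff)
    then show ?thesis using cardA by simp
  qed
  have carduv: "card (insert ?u (live i)) \<le> k"
  proof -
    have "insert ?u (live i) \<subseteq> A" "finite A" using finl by (auto simp: A_def)
    from card_mono[OF this(2,1)] show ?thesis using cardA by linarith
  qed
  obtain slt occ H \<tau> where m: "allocation (live i) {} slt occ H" "\<forall>x. slt x = 0 \<longleftrightarrow> x \<notin> seen i"
    "frame (last_incident M) slt occ H (target_reached i) i \<sigma>" "table \<tau> (projection i (live i) slt) \<sigma>"
    "\<forall>p. i \<le> p \<longrightarrow> p < M \<longrightarrow> \<tau> \<le> tm p"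
    using assms(1) unfolding main_def by blast
  have 1: "runs w load_arc \<sigma> 29 (round (seen i) (live i) {} i i)"
  proof (rule runs_mono[OF runs_load_arc[OF m(3,4) assms(2)]])
    fix \<sigma>'
    assume "arc_frame (last_incident M) slt occ H (target_reached i) i \<sigma>' \<and> table \<tau> (projection i (live i) slt) \<sigma>'"
    then show "round (seen i) (live i) {} i i \<sigma>'"
      using m(1,2,5) assms(2) represents_later unfolding round_def table_def by blast
  qed simp
  have uin: "?u \<in> live i \<longleftrightarrow> ?u \<in> seen i" and vin: "?v \<in> live i \<longleftrightarrow> ?v \<in> seen i"
    using assms(2) by (auto simp: live_def incident_def)
  have 2: "runs w (alloc 6) \<sigma>' (10 * k + 60) (round (insert ?u (seen i)) (insert ?u (live i)) (insert ?u {}) i i)"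
    if "round (seen i) (live i) {} i i \<sigma>'" for \<sigma>'
    by (rule runs_alloc_round[OF that]) (use uin carduv in auto)
  have 3: "runs w (alloc 7) \<sigma>' (10 * k + 60) (round Z A N i i)"
    if "round (insert ?u (seen i)) (insert ?u (live i)) (insert ?u {}) i i \<sigma>'" for \<sigma>'
    unfolding Z_def A_def N_def
    by (rule runs_alloc_round[OF that]) (use vin cardA in \<open>auto simp: A_def\<close>)
  have 4: "runs w extend \<sigma>' (2 ^ (k + 1) * 300 + 30) (round Z A N i (Suc i))" if "round Z A N i i \<sigma>'" for \<sigma>'
    by (rule runs_extend_round[OF that]) (auto simp: A_def)
  define A1 where "A1 = (if last_incident M ?u = i then A - {?u} else A)"
  define A2 where "A2 = (if last_incident M ?v = i then A1 - {?v} else A1)"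
  have 5: "runs w (free 6) \<sigma>' ((k + 1) * 2 ^ (k + 1) * 300 + 90) (round Z A1 N i (Suc i))"
    if "round Z A N i (Suc i) \<sigma>'" for \<sigma>'
    unfolding A1_def by (rule runs_free_round[OF that]) (auto simp: N_def)
  have 6: "runs w (free 7) \<sigma>' ((k + 1) * 2 ^ (k + 1) * 300 + 90) (round Z A2 N i (Suc i))"
    if "round Z A1 N i (Suc i) \<sigma>'" for \<sigma>'
    unfolding A2_def by (rule runs_free_round[OF that]) (auto simp: N_def)
  have Z: "Z = seen (Suc i)" by (auto simp: Z_def seen_Suc)
  \<comment> \<open>A touched node leaves exactly when arc \<open>i\<close> is its last one; an
    untouched node keeps its status.\<close>
  have A2: "A2 = live (Suc i)"
  proof (rule set_eqI)
    fix x
    show "x \<in> A2 \<longleftrightarrow> x \<in> live (Suc i)"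
    proof (cases "incident i x")
      case True
      then have "x \<in> A2 \<longleftrightarrow> last_incident M x \<noteq> i"
        by (auto simp: A2_def A1_def A_def incident_def)
      then show ?thesis
        using True last_incident_iff[OF True assms(2)] by (auto simp: live_def seen_Suc incident_def)
    next
      case False
      then have "x \<in> A2 \<longleftrightarrow> x \<in> live i" by (auto simp: A2_def A1_def A_def incident_def)
      moreover have "i \<le> q \<and> incident q x \<longleftrightarrow> Suc i \<le> q \<and> incident q x" for q
        using False by (metis Suc_le_eq le_less)
      ultimately show ?thesis
        using False by (auto simp: live_def seen_Suc incident_def)
    qed
  qed
  have 7: "runs w (incr 5) \<sigma>' 4 (main (Suc i))" if R: "round Z A2 N i (Suc i) \<sigma>'" for \<sigma>'
  proof -
    obtain slt occ H where r: "allocation A2 N slt occ H" "\<forall>x. slt x = 0 \<longleftrightarrow> x \<notin> Z"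
      "arc_frame (last_incident M) slt occ H (target_reached (Suc i)) i \<sigma>'"
      "table (tm i) (projection (Suc i) A2 slt) \<sigma>'"
      using R unfolding round_def by blast
    have al: "allocation (live (Suc i)) {} slt occ H"
      using r(1) unfolding A2 by (auto simp: allocation_def intro: inj_on_subset)
    have mono: "\<forall>p. Suc i \<le> p \<longrightarrow> p < M \<longrightarrow> tm i \<le> tm p" using tm_mono by simp
    have "frame (last_incident M) slt occ H (target_reached (Suc i)) i \<sigma>'"
      using r(3) by (simp add: arc_frame_def)
    then show ?thesis
    proof (rule runs_mono[OF runs_incr5[OF _ r(4) assms(2)] order_refl])
      fix \<sigma>''
      assume "frame (last_incident M) slt occ H (target_reached (Suc i)) (Suc i) \<sigma>'' \<and>
        table (tm i) (projection (Suc i) A2 slt) \<sigma>''"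
      then show "main (Suc i) \<sigma>''"
        unfolding main_def using al r(2) mono unfolding A2 Z
        by (intro exI[of _ slt] exI[of _ occ] exI[of _ H] exI[of _ "tm i"]) simp
    qed
  qed
  \<comment> \<open>In units of \<open>k * 2 ^ k\<close>, with \<open>k \<ge> 1\<close>: 2400 for
    the two releases, 600 for the extension, 20 for the slot searches, and less than 400 for all
    constants.\<close>
  have cost: "1 + 29 + (1 + (10 * k + 60) + (1 + (10 * k + 60) + (1 + (2 ^ (k + 1) * 300 + 30) +
      (1 + ((k + 1) * 2 ^ (k + 1) * 300 + 90) + (1 + ((k + 1) * 2 ^ (k + 1) * 300 + 90) + 4)))))
      \<le> 3500 * (k * 2 ^ k)"
  proof -
    have "2 ^ k \<le> k * (2::nat) ^ k" "k \<le> k * (2::nat) ^ k" "1 \<le> k * (2::nat) ^ k" using k by auto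
    moreover have "(k + 1) * 2 ^ (k + 1) = 2 * (k * 2 ^ k) + 2 * (2::nat) ^ k" "(2::nat) ^ (k + 1) = 2 * 2 ^ k"
      by (simp_all add: algebra_simps)
    ultimately show ?thesis by linarith
  qed
  show ?thesis
    unfolding arc_body_def
    by (rule runs_mono[OF runs_Seq[OF 1 runs_Seq[OF 2 runs_Seq[OF 3 runs_Seq[OF 4 runs_Seq[OF 5 runs_Seq[OF 6 7]]]]]] cost])
qed

end

section \<open>The whole program\<close>

lemma nth_concat_blocks:
  assumes "i < length xs" "c < 4"
  shows "concat (map (\<lambda>(u, v, \<tau>, \<delta>). [u, v, \<tau>, \<delta>]) xs) ! (4 * i + c)
    = [arc_tail (xs ! i), arc_head (xs ! i), arc_time (xs ! i), arc_delay (xs ! i)] ! c"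
  using assms
proof (induction xs arbitrary: i)
  case (Cons x xs)
  obtain u v \<tau> \<delta> where x: "x = (u, v, \<tau>, \<delta>)" by (cases x) auto
  show ?case
  proof (cases i)
    case 0
    then show ?thesis using Cons.prems x by (auto simp: nth_Cons')
  next
    case (Suc i')
    then show ?thesis using Cons.IH[of i'] Cons.prems x by (simp add: nth_append)
  qed
qed simp

lemma length_concat_blocks:
  "length (concat (map (\<lambda>(u, v, \<tau>, \<delta>). [u, v, \<tau>, \<delta>]) xs)) = 4 * length xs"
  by (induction xs) auto

context ram_input
begin

lemma runs_last_body:
  assumes "frame (last_incident i) (\<lambda>_. 0) 1 1 b i \<sigma>" "table 0 (\<lambda>_ _. {}) \<sigma>" "i < M"
  shows "runs w last_body \<sigma> 70 (\<lambda>\<sigma>'. frame (last_incident (Suc i)) (\<lambda>_. 0) 1 1 b (Suc i) \<sigma>' \<and>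
    table 0 (\<lambda>_ _. {}) \<sigma>')"
proof -
  let ?lst = "(last_incident i)(src i := i)"
  have bd: "src i \<le> mx" "dst i \<le> mx" using arc_bound[OF assms(3)] by auto
  note 1 = runs_load_arc[OF assms]
  have 2: "runs w (Store (addr_expr 0 (node_expr (Reg 6))) (Reg 5)) \<sigma>' 11
      (\<lambda>\<sigma>'. arc_frame ?lst (\<lambda>_. 0) 1 1 b i \<sigma>' \<and> table 0 (\<lambda>_ _. {}) \<sigma>')"
    if "arc_frame (last_incident i) (\<lambda>_. 0) 1 1 b i \<sigma>' \<and> table 0 (\<lambda>_ _. {}) \<sigma>'" for \<sigma>'
  proof -
    have "eval_expr w (addr_expr 0 (node_expr (Reg 6))) \<sigma>' = last_addr (src i)"
      by (rule eval_node(1)) (use that bd in \<open>auto simp: frame_defs\<close>)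
    then show ?thesis using that by (intro runs_loop_free) (simp_all add: frame_defs)
  qed
  have 3: "runs w (Store (addr_expr 0 (node_expr (Reg 7))) (Reg 5)) \<sigma>' 11
      (\<lambda>\<sigma>'. arc_frame (last_incident (Suc i)) (\<lambda>_. 0) 1 1 b i \<sigma>' \<and> table 0 (\<lambda>_ _. {}) \<sigma>')"
    if "arc_frame ?lst (\<lambda>_. 0) 1 1 b i \<sigma>' \<and> table 0 (\<lambda>_ _. {}) \<sigma>'" for \<sigma>'
  proof -
    have "eval_expr w (addr_expr 0 (node_expr (Reg 7))) \<sigma>' = last_addr (dst i)"
      by (rule eval_node(1)) (use that bd in \<open>auto simp: frame_defs\<close>)
    then show ?thesis using that by (intro runs_loop_free) (simp_all add: frame_defs)
  qed
  have 4: "runs w (incr 5) \<sigma>' 4 (\<lambda>\<sigma>'. frame (last_incident (Suc i)) (\<lambda>_. 0) 1 1 b (Suc i) \<sigma>' \<and>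
      table 0 (\<lambda>_ _. {}) \<sigma>')"
    if "arc_frame (last_incident (Suc i)) (\<lambda>_. 0) 1 1 b i \<sigma>' \<and> table 0 (\<lambda>_ _. {}) \<sigma>'" for \<sigma>'
    using that by (intro runs_incr5[OF _ _ assms(3)]) (simp_all add: arc_frame_def)
  show ?thesis
    unfolding last_body_def
    by (rule runs_mono[OF runs_Seq[OF 1 runs_Seq[OF 2 runs_Seq[OF 3 4]]]]) auto
qed

lemma runs_init:
  "runs w init (initial_state (input_words arcs s t \<Delta>)) 30
     (\<lambda>\<sigma>. frame (\<lambda>_. 0) (\<lambda>_. 0) 1 1 (s = t) 0 \<sigma> \<and> table 0 (\<lambda>_ _. {}) \<sigma>)"
proof -
  let ?ws = "input_words arcs s t \<Delta>" and ?\<sigma> = "initial_state (input_words arcs s t \<Delta>)"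
  have len: "length ?ws = 4 * (M + 1)"
    by (simp add: input_words_def length_concat_blocks M_def)
  have hd4: "mem ?\<sigma> 0 = M" "mem ?\<sigma> (Suc 0) = s" "mem ?\<sigma> 2 = t" "mem ?\<sigma> 3 = \<Delta>"
    using len by (simp_all add: initial_state_def) (simp_all add: input_words_def M_def)
  have inp: "mem ?\<sigma> (in_addr c p) = [src p, dst p, tm p, arc_delay (arcs ! p)] ! c" if "p < M" "c < 4" for p c
  proof -
    have "mem ?\<sigma> (in_addr c p) = ?ws ! (4 + (4 * p + c))"
      using that len by (simp add: initial_state_def in_addr_def add.assoc)
    also have "\<dots> = concat (map (\<lambda>(u, v, \<tau>, \<delta>). [u, v, \<tau>, \<delta>]) arcs) ! (4 * p + c)"
      by (simp add: input_words_def nth_append)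
    finally show ?thesis
      using that by (simp add: nth_concat_blocks M_def src_def dst_def tm_def)
  qed
  have rest: "mem ?\<sigma> (last_addr x) = 0" "mem ?\<sigma> (slot_addr x) = 0" "mem ?\<sigma> (new_addr S j) = 0" for x S j
    using len by (simp_all add: initial_state_def addr_defs)
  have regs: "regs ?\<sigma> r = 0" for r by (simp add: initial_state_def)
  show ?thesis
    using inp[of _ 0] inp[of _ 1] inp[of _ 2]
    by (intro runs_loop_free)
      (simp_all add: init_def frame_defs hd4 rest regs represents_empty)
qed

theorem runs_prog:
  "runs w prog (initial_state (input_words arcs s t \<Delta>)) (4000 * max 1 (M * k * 2 ^ k))
     (\<lambda>\<sigma>. regs \<sigma> 0 = of_bool (point_restless_temporal_path (set arcs) s t \<Delta>))"
proof -
  let ?g = "Op Less (Reg 5) (Reg 1)"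
  define L where "L = (\<lambda>i \<sigma>. frame (last_incident i) (\<lambda>_. 0) 1 1 (s = t) i \<sigma> \<and> table 0 (\<lambda>_ _. {}) \<sigma>)"
  have g: "eval_expr w ?g \<sigma> = of_bool (i < M)" if "frame lst slt occ H b i \<sigma>" for lst slt occ H b i \<sigma>
    using that by (simp add: frame_def)
  have 1: "runs w init (initial_state (input_words arcs s t \<Delta>)) 30 (L 0)"
    using runs_init by (simp add: L_def)
  have 2: "runs w (While ?g last_body) \<sigma> (M * (1 + expr_cost ?g + 70) + (1 + expr_cost ?g)) (L M)" if "L 0 \<sigma>" for \<sigma>
  proof (rule runs_While[of L, OF that])
    show "eval_expr w ?g \<sigma>' \<noteq> 0 \<and> runs w last_body \<sigma>' 70 (L (Suc i))" if "i < M" "L i \<sigma>'" for i \<sigma>'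
      using g[of "last_incident i" "\<lambda>_. 0" 1 1 "s = t" i \<sigma>'] runs_last_body[of i "s = t" \<sigma>'] that
      unfolding L_def by auto
    show "eval_expr w ?g \<sigma>' = 0" if "L M \<sigma>'" for \<sigma>'
      using that g[of "last_incident M" "\<lambda>_. 0" 1 1 "s = t" M \<sigma>'] unfolding L_def by auto
  qed
  have 3: "runs w (Assign 5 (Const 0)) \<sigma> 2 (main 0)" if "L M \<sigma>" for \<sigma>
  proof (rule runs_loop_free)
    have "set_decode 1 = {0}" using set_encode_inverse[of "{0}"] by (simp add: set_encode_def)
    then have "allocation (live 0) {} (\<lambda>_. 0) 1 1" by (simp add: allocation_def live_def seen_def)
    moreover have "frame (last_incident M) (\<lambda>_. 0) 1 1 (target_reached 0) 0 (sem w (Assign 5 (Const 0)) \<sigma>)"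
      using that by (simp add: L_def frame_def target_reached_def)
    moreover have "table 0 (projection 0 (live 0) (\<lambda>_. 0)) (sem w (Assign 5 (Const 0)) \<sigma>)"
    proof -
      have "projection 0 (live 0) (\<lambda>_. 0) = (\<lambda>_ _. {})" by (simp add: projection_def fun_eq_iff)
      then show ?thesis using that by (simp add: L_def)
    qed
    ultimately show "main 0 (sem w (Assign 5 (Const 0)) \<sigma>)"
      unfolding main_def
      by (intro exI[of _ "\<lambda>_. 0"] exI[of _ 1] exI[of _ 0]) (simp add: seen_def)
  qed simp_all
  have 4: "runs w (While ?g arc_body) \<sigma> (M * (1 + expr_cost ?g + 3500 * (k * 2 ^ k)) + (1 + expr_cost ?g)) (main M)"
    if "main 0 \<sigma>" for \<sigma>
  proof (rule runs_While[of main, OF that])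
    show "eval_expr w ?g \<sigma>' \<noteq> 0 \<and> runs w arc_body \<sigma>' (3500 * (k * 2 ^ k)) (main (Suc i))"
      if "i < M" "main i \<sigma>'" for i \<sigma>'
    proof
      show "eval_expr w ?g \<sigma>' \<noteq> 0" using that g unfolding main_def by fastforce
    qed (rule runs_arc_body[OF that(2,1)])
    show "eval_expr w ?g \<sigma>' = 0" if "main M \<sigma>'" for \<sigma>'
      using that g unfolding main_def by fastforce
  qed
  have cost: "1 + 30 + (1 + (M * (1 + expr_cost ?g + 70) + (1 + expr_cost ?g)) + (1 + 2 +
      (M * (1 + expr_cost ?g + 3500 * (k * 2 ^ k)) + (1 + expr_cost ?g)))) \<le> 4000 * max 1 (M * k * 2 ^ k)"
  \<comment> \<open>Without arcs only a fixed number of steps remains, covered by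
    \<open>max 1\<close>; otherwise \<open>k \<ge> 1\<close>, and everything is absorbed by the
    product.\<close>
  proof (cases "M = 0")
    case False
    then have "0 < card (insert (src 0) (insert (dst 0) (live 0)))"
      using finite_seen[of 0] by (simp add: card_gt_0_iff live_def)
    then have "1 \<le> k" using width[of 0] False by simp
    then have "1 \<le> k * 2 ^ k" by simp
    then have "M \<le> M * (k * 2 ^ k)" by simp
    moreover have "M * (1 + expr_cost ?g + 70) = 74 * M" "1 + expr_cost ?g = 4"
      "M * (1 + expr_cost ?g + 3500 * (k * 2 ^ k)) = 4 * M + 3500 * (M * (k * 2 ^ k))"
      by (simp_all add: algebra_simps)
    moreover have "1 \<le> M" using False by simp
    ultimately have "1 + 30 + (1 + (M * (1 + expr_cost ?g + 70) + (1 + expr_cost ?g)) + (1 + 2 +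
      (M * (1 + expr_cost ?g + 3500 * (k * 2 ^ k)) + (1 + expr_cost ?g)))) \<le> 4000 * (M * (k * 2 ^ k))"
      by linarith
    also have "\<dots> \<le> 4000 * max 1 (M * k * 2 ^ k)" unfolding mult.assoc by (intro mult_left_mono) auto
    finally show ?thesis .
  qed simp
  show ?thesis
    unfolding prog_def
  proof (rule runs_mono[OF runs_Seq[OF 1 runs_Seq[OF 2 runs_Seq[OF 3 4]]] cost])
    fix \<sigma> assume "main M \<sigma>"
    then have "regs \<sigma> 0 = of_bool (target_reached M)" unfolding main_def frame_def by blast
    then show "regs \<sigma> 0 = of_bool (point_restless_temporal_path (set arcs) s t \<Delta>)"
      by (simp only: reach_correct target_reached_def)
  qed
qed

end

text \<open>An active node is an endpoint of some arc. This justifies the row length of the table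
  and gives width 0 for graphs without arcs.\<close>

lemma vim_width_le:
  assumes "finite E"
  shows "vim_width V E \<le> 2 * card E"
proof -
  have "card (active V E \<tau>) \<le> 2 * card E" for \<tau>
  proof -
    have "active V E \<tau> \<subseteq> arc_tail ` E \<union> arc_head ` E"
      by (fastforce simp: active_def incident_arcs_def intro: rev_image_eqI)
    then have "card (active V E \<tau>) \<le> card (arc_tail ` E \<union> arc_head ` E)"
      using assms by (intro card_mono) auto
    also have "\<dots> \<le> card (arc_tail ` E) + card (arc_head ` E)" by (rule card_Un_le)
    also have "\<dots> \<le> card E + card E" using assms by (intro add_mono card_image_le)
    finally show ?thesis by simp
  qed
  then show ?thesis unfolding vim_width_def by (intro Max.boundedI) auto
qed

theorem theorem1:
  shows "\<exists>(P :: com) (C :: nat). 0 < C \<and>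
    (\<forall>(V :: nat set) (E :: nat timed_arc set) (arcs :: nat timed_arc list)
       (s :: nat) (t :: nat) (\<Delta> :: nat) (w :: nat).
       point_temporal_graph V E \<longrightarrow> uniform_delay_one E \<longrightarrow> arc_list_of E arcs \<longrightarrow>
       s \<in> V \<longrightarrow> t \<in> V \<longrightarrow>
       word_length_ok C (input_words arcs s t \<Delta>) (time_bound V E) w \<longrightarrow>
       (\<exists>n \<sigma>. exec w P (initial_state (input_words arcs s t \<Delta>)) n \<sigma> \<and>
          n \<le> C * time_bound V E \<and>
          regs \<sigma> 0 = (if point_restless_temporal_path E s t \<Delta> then 1 else 0)))"
proof (rule exI[of _ prog], rule exI[of _ 4000], intro conjI allI impI)
  fix V :: "nat set" and E :: "nat timed_arc set" and arcs :: "nat timed_arc list" and s t \<Delta> w :: nat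
  assume G: "point_temporal_graph V E" and E1: "uniform_delay_one E" and arcs: "arc_list_of E arcs"
    and word: "word_length_ok 4000 (input_words arcs s t \<Delta>) (time_bound V E) w"
  define k where "k = vim_width V E"
  define mx where "mx = Max (set (input_words arcs s t \<Delta>))"
  have E: "E = set arcs" "card E = length arcs"
    using arcs by (auto simp: arc_list_of_def distinct_card)
  interpret temporal_input arcs s t \<Delta>
    using E1 arcs by unfold_locales (auto simp: uniform_delay_one_def arc_list_of_def)
  have T: "time_bound V E = max 1 (M * k * 2 ^ k)"
    by (simp add: time_bound_def E(2) M_def k_def)
  \<comment> \<open>One constant serves both as time factor and as word-length constant; the word
    bounds below are derived from it with much slack.\<close>
  have W: "4000 * (mx + max 1 (M * k * 2 ^ k)) \<le> 2 ^ w"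
    using word unfolding word_length_ok_def T mx_def .
  have mx: "x \<le> mx" if "x \<in> set (input_words arcs s t \<Delta>)" for x
    unfolding mx_def using that by (intro Max_ge) auto
  have width: "card (insert (src i) (insert (dst i) (live i))) \<le> k" if "i < M" for i
    unfolding k_def E(1) by (rule live_active[OF G[unfolded E(1)] that])
  have table: "4 * M + 4 + 4 * (2 ^ (k + 2) * (2 * M + 1)) \<le> 2 ^ w \<and> (k + 1) * 2 ^ (k + 1) < 2 ^ w"
  proof (cases "M = 0")
    case True
    then have "k = 0" using vim_width_le[of E V] E(2) by (simp add: k_def M_def E(1))
    then show ?thesis using W True by simp
  next
    case False
    let ?T = "M * k * 2 ^ k"
    have "0 < card (insert (src 0) (insert (dst 0) (live 0)))"
      using finite_seen[of 0] by (simp add: card_gt_0_iff live_def)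
    then have k: "1 \<le> k" using width[of 0] False by simp
    \<comment> \<open>\<open>M\<close> and \<open>k\<close> are positive, so each factor of
      \<open>?T\<close> may be dropped; the table size is thus linear in \<open>?T\<close>.\<close>
    have "M * 2 ^ k \<le> ?T" "2 ^ k \<le> ?T" "k * 2 ^ k \<le> ?T" "M \<le> ?T" using k False by (auto simp: mult.assoc)
    moreover have "2 ^ (k + 2) * (2 * M + 1) = 8 * (M * 2 ^ k) + 4 * 2 ^ k"
      "(k + 1) * 2 ^ (k + 1) = 2 * (k * 2 ^ k) + 2 * 2 ^ k" by (simp_all add: algebra_simps)
    moreover have "4000 * ?T \<le> 2 ^ w" "4000 \<le> (2::nat) ^ w" using W max.cobounded1[of 1 ?T] max.cobounded2[of ?T 1]
      unfolding distrib_left by linarith+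
    ultimately show ?thesis by linarith
  qed
  interpret ram_input arcs s t \<Delta> w k mx
  proof
    show "src i \<le> mx \<and> dst i \<le> mx \<and> tm i \<le> mx" if "i < M" for i
    proof -
      obtain u v \<tau> \<delta> where e: "arcs ! i = (u, v, \<tau>, \<delta>)" by (cases "arcs ! i") auto
      then have "(u, v, \<tau>, \<delta>) \<in> set arcs" using that nth_mem[of i arcs] by (simp add: M_def)
      then have "{u, v, \<tau>} \<subseteq> set (input_words arcs s t \<Delta>)"
        unfolding input_words_def by (auto intro!: bexI[of _ "(u, v, \<tau>, \<delta>)"])
      then have "{src i, dst i, tm i} \<subseteq> set (input_words arcs s t \<Delta>)"
        by (simp add: src_def dst_def tm_def e)
      then show ?thesis using mx by auto
    qed
    show "M \<le> mx" "\<Delta> \<le> mx" using mx by (auto simp: input_words_def M_def)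
    show "8 * mx + 16 \<le> 2 ^ w"
      using W max.cobounded1[of 1 "M * k * 2 ^ k"] unfolding distrib_left by linarith
    show "k \<le> 2 * M" using vim_width_le[of E V] E by (simp add: k_def M_def)
  qed (use table width in auto)
  show "\<exists>n \<sigma>. exec w prog (initial_state (input_words arcs s t \<Delta>)) n \<sigma> \<and> n \<le> 4000 * time_bound V E \<and>
      regs \<sigma> 0 = (if point_restless_temporal_path E s t \<Delta> then 1 else 0)"
    unfolding T using runs_prog unfolding runs_def E(1)[symmetric] of_bool_def by blast
qed simp

end
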